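(* Let $\mathbb{K}$ be a field, $R=\mathbb{K}[X_1,\ldots,X_n]$ the standard graded polynomial ring, $I\subset R$ a homogeneous ideal and $m\ge 2$ an integer. Then $\beta_{i,j}(R/I^{[m]})\neq 0$ only if $j=mk$ for some $k$ with $\beta_{i,k}(R/I)\ne 0$. Moreover, $\beta_{i,mk}(R/I^{[m]})=\beta_{i,k}(R/I)$ for every $k$ and every $i\ge 0$.
   Context: For $f\in R$ and a positive integer $m$, $f^{[m]}:=f(X_1^m,\ldots,X_n^m)$, and the $m$-th square power of an ideal $I\subset R$ is the ideal $I^{[m]}:=\langle f^{[m]} : f\in I\rangle$ of $R$. The graded Betti numbers are $\beta_{i,j}(R/I)=\dim_{\mathbb{K}}\operatorname{Tor}_i^R(\mathbb{K},R/I)_j$ for $i\ge 0$, $j\in\mathbb{Z}$. *)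

theory Defs
  imports Complex_Main "HOL-Library.Poly_Mapping" "HOL-Library.Function_Algebras"
begin

section \<open>The polynomial ring\<close>

text \<open>
  The ring \<open>K[X\<^sub>1,\<dots>,X\<^sub>n]\<close> has variables indexed by a finite type \<open>'n\<close>, so \<open>n\<close> is the
  cardinality of \<open>'n\<close>; an exponent vector is an element of \<open>'n \<Rightarrow>\<^sub>0 nat\<close>.
\<close>

type_synonym ('n, 'k) mpoly = "('n \<Rightarrow>\<^sub>0 nat) \<Rightarrow>\<^sub>0 'k"

definition Const :: "'k::field \<Rightarrow> ('n::finite, 'k) mpoly" where
  "Const a = Poly_Mapping.single 0 a"

definition Var :: "'n::finite \<Rightarrow> ('n, 'k::field) mpoly" where
  "Var i = Poly_Mapping.single (Poly_Mapping.single i 1) 1"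

definition subst :: "('n::finite \<Rightarrow> ('n, 'k::field) mpoly) \<Rightarrow> ('n, 'k) mpoly \<Rightarrow> ('n, 'k) mpoly" where
  "subst g f = (\<Sum>t\<in>Poly_Mapping.keys f.
     Const (Poly_Mapping.lookup f t) * (\<Prod>i\<in>UNIV. g i ^ Poly_Mapping.lookup t i))"

definition total_degree :: "('n::finite \<Rightarrow>\<^sub>0 nat) \<Rightarrow> nat" where
  "total_degree t = (\<Sum>i\<in>UNIV. Poly_Mapping.lookup t i)"

text \<open>Degrees are integers; the components of negative degree are zero.\<close>

definition homogeneous_component :: "int \<Rightarrow> ('n::finite, 'k::field) mpoly set" where
  "homogeneous_component d = {f. \<forall>t\<in>Poly_Mapping.keys f. int (total_degree t) = d}"

section \<open>Ideals and square powers\<close>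

text \<open>Ideals of a commutative ring are the submodules of the ring acting on itself.\<close>

lemma module_mult: "module ((*) :: 'a::comm_ring_1 \<Rightarrow> 'a \<Rightarrow> 'a)"
  by unfold_locales (simp_all add: algebra_simps)

definition ideal :: "'a::comm_ring_1 set \<Rightarrow> bool" where
  "ideal I \<longleftrightarrow> module.subspace (*) I"

definition ideal_generated :: "'a::comm_ring_1 set \<Rightarrow> 'a set" where
  "ideal_generated S = module.span (*) S"

definition homogeneous_ideal :: "('n::finite, 'k::field) mpoly set \<Rightarrow> bool" where
  "homogeneous_ideal I \<longleftrightarrow> ideal I \<and>
     (\<exists>G \<subseteq> (\<Union>d. homogeneous_component d). I = ideal_generated G)"

definition square_power_poly :: "nat \<Rightarrow> ('n::finite, 'k::field) mpoly \<Rightarrow> ('n, 'k) mpoly" where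
  "square_power_poly m f = subst (\<lambda>i. Var i ^ m) f"

definition square_power :: "nat \<Rightarrow> ('n::finite, 'k::field) mpoly set \<Rightarrow> ('n, 'k) mpoly set" where
  "square_power m I = ideal_generated (square_power_poly m ` I)"

section \<open>Graded free resolutions\<close>

text \<open>
  A complex \<open>\<dots> \<rightarrow> F\<^sub>2 \<rightarrow> F\<^sub>1 \<rightarrow> F\<^sub>0\<close> of graded free modules of finite rank, given in coordinates:
  \<open>F\<^sub>i\<close> has a basis \<open>e\<^sub>i\<^sub>b\<close> with \<open>b < rk i\<close> and \<open>e\<^sub>i\<^sub>b\<close> of degree \<open>bdeg i b\<close> (so \<open>F\<^sub>i\<close> is the direct
  sum of the shifted modules \<open>R(- bdeg i b)\<close>). For \<open>i \<ge> 1\<close> the matrix \<open>dmat i\<close>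
  has in row \<open>c\<close> and column \<open>b\<close> the coefficient at the \<open>c\<close>-th basis element of \<open>F\<^bsub>i-1\<^esub>\<close> of the
  image of \<open>e\<^sub>i\<^sub>b\<close>; the value of
  \<open>dmat 0\<close> is irrelevant. The augmentation \<open>F\<^sub>0 \<rightarrow> R/I\<close> maps \<open>e\<^sub>0\<^sub>b\<close> to the class of \<open>aug b\<close>.
\<close>

record 'r graded_complex =
  rk :: "nat \<Rightarrow> nat"
  bdeg :: "nat \<Rightarrow> nat \<Rightarrow> int"
  dmat :: "nat \<Rightarrow> nat \<Rightarrow> nat \<Rightarrow> 'r"
  aug :: "nat \<Rightarrow> 'r"

definition free_module :: "nat \<Rightarrow> (nat \<Rightarrow> 'a::zero) set" where
  "free_module r = {v. \<forall>b\<ge>r. v b = 0}"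

text \<open>
  The ring of coefficients is left open in order to cover both \<open>F\<close> and \<open>K \<otimes> F\<close>.
  The differential leaving position \<open>0\<close> is the zero map.
\<close>

definition differential ::
  "(nat \<Rightarrow> nat) \<Rightarrow> (nat \<Rightarrow> nat \<Rightarrow> nat \<Rightarrow> 'a::comm_ring_1) \<Rightarrow> nat \<Rightarrow> (nat \<Rightarrow> 'a) \<Rightarrow> nat \<Rightarrow> 'a" where
  "differential r A i v =
     (\<lambda>c. if 0 < i \<and> c < r (i - 1) then (\<Sum>b<r i. A i c b * v b) else 0)"

definition augmentation :: "('n::finite, 'k::field) mpoly graded_complex \<Rightarrow> (nat \<Rightarrow> ('n, 'k) mpoly) \<Rightarrow> ('n, 'k) mpoly" where
  "augmentation F v = (\<Sum>b<rk F 0. aug F b * v b)"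

text \<open>
  The five conditions: the augmentation and the differentials are homogeneous of degree \<open>0\<close>, the
  augmentation is onto \<open>R/I\<close>, and the augmented complex is exact at \<open>F\<^sub>0\<close> and at every \<open>F\<^sub>i\<close>, \<open>i \<ge> 1\<close>.
\<close>

definition graded_free_resolution ::
  "('n::finite, 'k::field) mpoly graded_complex \<Rightarrow> ('n, 'k) mpoly set \<Rightarrow> bool" where
  "graded_free_resolution F I \<longleftrightarrow>
     (\<forall>b<rk F 0. aug F b \<in> homogeneous_component (bdeg F 0 b)) \<and>
     (\<forall>i\<ge>1. \<forall>c<rk F (i - 1). \<forall>b<rk F i.
        dmat F i c b \<in> homogeneous_component (bdeg F i b - bdeg F (i - 1) c)) \<and>
     (\<forall>f. \<exists>v\<in>free_module (rk F 0). f - augmentation F v \<in> I) \<and>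
     {v \<in> free_module (rk F 0). augmentation F v \<in> I} =
        differential (rk F) (dmat F) 1 ` free_module (rk F 1) \<and>
     (\<forall>i\<ge>1. {v \<in> free_module (rk F i). differential (rk F) (dmat F) i v = 0} =
        differential (rk F) (dmat F) (i + 1) ` free_module (rk F (i + 1)))"

section \<open>Tor and graded Betti numbers\<close>

text \<open>
  \<open>K = R/(X\<^sub>1,\<dots>,X\<^sub>n)\<close> is the \<open>R\<close>-module, concentrated in degree \<open>0\<close>, on which \<open>f\<close> acts through its
  constant coefficient. Hence \<open>K \<otimes> F\<^sub>i\<close> is the \<open>K\<close>-vector space with basis \<open>1 \<otimes> e\<^sub>i\<^sub>b\<close> in degree
  \<open>bdeg i b\<close>, and the matrices of its differentials are the constant coefficients of \<open>dmat\<close>.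
\<close>

definition const_coeff :: "('n::finite, 'k::field) mpoly \<Rightarrow> 'k" where
  "const_coeff f = Poly_Mapping.lookup f 0"

definition tensor_piece :: "('n::finite, 'k::field) mpoly graded_complex \<Rightarrow> nat \<Rightarrow> int \<Rightarrow> (nat \<Rightarrow> 'k) set" where
  "tensor_piece F i j = {v \<in> free_module (rk F i). \<forall>b. v b \<noteq> 0 \<longrightarrow> bdeg F i b = j}"

definition tensor_differential ::
  "('n::finite, 'k::field) mpoly graded_complex \<Rightarrow> nat \<Rightarrow> (nat \<Rightarrow> 'k) \<Rightarrow> nat \<Rightarrow> 'k" where
  "tensor_differential F = differential (rk F) (\<lambda>i c b. const_coeff (dmat F i c b))"

definition tor_cycles :: "('n::finite, 'k::field) mpoly graded_complex \<Rightarrow> nat \<Rightarrow> int \<Rightarrow> (nat \<Rightarrow> 'k) set" where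
  "tor_cycles F i j = {v \<in> tensor_piece F i j. tensor_differential F i v = 0}"

definition tor_boundaries :: "('n::finite, 'k::field) mpoly graded_complex \<Rightarrow> nat \<Rightarrow> int \<Rightarrow> (nat \<Rightarrow> 'k) set" where
  "tor_boundaries F i j = tensor_differential F (i + 1) ` tensor_piece F (i + 1) j"

lemma vector_space_fun: "vector_space (\<lambda>(a::'k::field) (v::nat \<Rightarrow> 'k) b. a * v b)"
  by unfold_locales (simp_all add: fun_eq_iff algebra_simps)

text \<open>
  \<open>Tor\<^sub>i(K, R/I)\<^sub>j\<close> is the quotient of \<open>tor_cycles F i j\<close> by \<open>tor_boundaries F i j\<close> for a graded free
  resolution \<open>F\<close> of \<open>R/I\<close>. The ranks are finite, so the dimension of the quotient is the difference
  of the dimensions.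
\<close>

definition tor_dim :: "('n::finite, 'k::field) mpoly graded_complex \<Rightarrow> nat \<Rightarrow> int \<Rightarrow> nat" where
  "tor_dim F i j =
     vector_space.dim (\<lambda>(a::'k) v b. a * v b) (tor_cycles F i j) -
     vector_space.dim (\<lambda>(a::'k) v b. a * v b) (tor_boundaries F i j)"

text \<open>
  The number \<open>\<beta>\<^sub>i\<^sub>j(R/I)\<close> of a homogeneous ideal \<open>I\<close>. A resolution of finite rank exists since \<open>R\<close> is
  Noetherian, and the result does not depend on the choice.
\<close>

definition betti :: "('n::finite, 'k::field) mpoly set \<Rightarrow> nat \<Rightarrow> int \<Rightarrow> nat" where
  "betti I i j = tor_dim (SOME F. graded_free_resolution F I) i j"

end

theory Submission
  imports Defs "HOL-Computational_Algebra.Primes"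
begin

text \<open>
  The ring \<open>R\<close> is free over the subring \<open>K[X\<^sub>1\<^sup>m, \<dots>, X\<^sub>n\<^sup>m]\<close>, with the monomials whose exponents are all
  less than \<open>m\<close> as a basis. Substituting \<open>X\<^sub>i\<^sup>m\<close> for \<open>X\<^sub>i\<close> in the matrices of a graded free resolution of
  \<open>R/I\<close> therefore preserves exactness, since an equation over \<open>R\<close> splits into equations between
  coordinates. The result is a graded free resolution of \<open>R/I\<^bsup>[m]\<^esup>\<close> in which all degrees are multiplied
  by \<open>m\<close>; the constant coefficients of the matrices, which determine \<open>Tor\<close>, do not change.
  The Betti numbers can be read off this particular resolution because resolutions exist (Dickson's
  lemma gives finite generation of submodules) and any two of them are homotopy equivalent.
\<close>

section \<open>Polynomials\<close>

text \<open>\<open>betti\<close> takes its resolution by Hilbert choice, so nothing is known about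
  it until resolutions are shown to exist and \<open>tor_dim\<close> to agree on all of them; most
  of the development pays for this. Two decisions keep the cost down. Quotients are never formed:
  R/I is represented by R with congruence modulo I, and homology by a pair of subspaces. For two
  resolutions only \<open>tor_dim F i j \<le> tor_dim G i j\<close> is proved, from a chain map that
  is injective on homology; exchanging F and G gives equality. Lifts and homotopies have to be of
  degree 0 throughout, since otherwise they would not respect the piece of degree j. Constant
  coefficients survive the substitution because, for nonzero m, scaling by m sends no exponent
  vector other than 0 to 0. All basis degrees become multiples of m, which is why Tor vanishes in
  every other degree.\<close>

abbreviation monomial :: "('n \<Rightarrow>\<^sub>0 nat) \<Rightarrow> 'k::field \<Rightarrow> ('n, 'k) mpoly" where
  "monomial \<equiv> Poly_Mapping.single"

lemma mpoly_eq_sum_monomials: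
  fixes f :: "('n, 'k::field) mpoly"
  shows "f = (\<Sum>t\<in>Poly_Mapping.keys f. monomial t (Poly_Mapping.lookup f t))"
proof (rule poly_mapping_eqI)
  fix s
  have "(\<Sum>t\<in>Poly_Mapping.keys f. Poly_Mapping.lookup (monomial t (Poly_Mapping.lookup f t)) s)
      = (\<Sum>t\<in>Poly_Mapping.keys f. if t = s then Poly_Mapping.lookup f s else 0)"
    by (rule sum.cong) (auto simp: lookup_single when_def)
  then show "Poly_Mapping.lookup f s
      = Poly_Mapping.lookup (\<Sum>t\<in>Poly_Mapping.keys f. monomial t (Poly_Mapping.lookup f t)) s"
    by (simp add: lookup_sum in_keys_iff)
qed

lemma mpoly_induct [case_names monomial add]:
  fixes f :: "('n, 'k::field) mpoly"
  assumes monomial: "\<And>t c. P (monomial t c)" and add: "\<And>f g. P f \<Longrightarrow> P g \<Longrightarrow> P (f + g)"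
  shows "P f"
proof -
  have P0: "P 0" using monomial[of 0 0] by simp
  have "P (\<Sum>t\<in>T. monomial t (Poly_Mapping.lookup f t))" for T
    by (induction T rule: infinite_finite_induct) (simp_all add: P0 assms)
  then show ?thesis by (subst mpoly_eq_sum_monomials) simp
qed

lemma lookup_monomial_mult:
  fixes f :: "('n, 'k::field) mpoly"
  shows "Poly_Mapping.lookup (monomial s c * f) (s + t) = c * Poly_Mapping.lookup f t"
  by (induction f rule: mpoly_induct)
    (simp_all add: mult_single lookup_single distrib_left lookup_add when_def)

lemma keys_monomial_mult:
  fixes f :: "('n, 'k::field) mpoly"
  shows "Poly_Mapping.keys (monomial s c * f) \<subseteq> (+) s ` Poly_Mapping.keys f"
  using keys_mult[of "monomial s c" f] by (auto split: if_splits)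

lemma const_coeff_zero [simp]: "const_coeff 0 = 0"
  and const_coeff_Const [simp]: "const_coeff (Const a) = a"
  and const_coeff_add: "const_coeff (f + g) = const_coeff f + const_coeff g"
  and const_coeff_diff: "const_coeff (f - g) = const_coeff f - const_coeff g"
  and const_coeff_sum: "const_coeff (sum h A) = (\<Sum>x\<in>A. const_coeff (h x))"
  by (simp_all add: const_coeff_def Const_def lookup_add lookup_minus lookup_sum)

lemma exponent_add_eq_0_iff: "s + t = 0 \<longleftrightarrow> s = 0 \<and> t = (0 :: 'n \<Rightarrow>\<^sub>0 nat)"
  by (auto simp: poly_mapping_eq_iff fun_eq_iff lookup_add)

lemma const_coeff_mult: "const_coeff (f * g) = const_coeff f * const_coeff g"
proof (induction f rule: mpoly_induct)
  case (monomial s a)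
  show ?case
    by (induction g rule: mpoly_induct)
      (auto simp: const_coeff_def mult_single lookup_single distrib_left lookup_add when_def
        exponent_add_eq_0_iff)
qed (simp add: distrib_right const_coeff_add)

subsection \<open>Homogeneous components\<close>

lemma total_degree_add: "total_degree (s + t) = total_degree s + total_degree t"
  by (simp add: total_degree_def lookup_add sum.distrib)

lemma homogeneous_component_zero [simp]: "0 \<in> homogeneous_component d"
  by (simp add: homogeneous_component_def)

lemma homogeneous_component_add:
  "f \<in> homogeneous_component d \<Longrightarrow> g \<in> homogeneous_component d \<Longrightarrow>
    f + g \<in> homogeneous_component d"
  using keys_add[of f g] by (auto simp: homogeneous_component_def)

lemma homogeneous_component_uminus:
  "f \<in> homogeneous_component d \<Longrightarrow> - f \<in> homogeneous_component d"
  by (auto simp: homogeneous_component_def in_keys_iff)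

lemma homogeneous_component_sum:
  "(\<And>x. x \<in> A \<Longrightarrow> f x \<in> homogeneous_component d) \<Longrightarrow> sum f A \<in> homogeneous_component d"
  by (induction A rule: infinite_finite_induct) (auto intro: homogeneous_component_add)

lemma homogeneous_component_one: "1 \<in> homogeneous_component 0"
  by (simp add: homogeneous_component_def total_degree_def)

definition hproj :: "int \<Rightarrow> ('n::finite, 'k::field) mpoly \<Rightarrow> ('n, 'k) mpoly" where
  "hproj d = Poly_Mapping.mapp (\<lambda>t c. c when int (total_degree t) = d)"

lemma lookup_hproj:
  "Poly_Mapping.lookup (hproj d f) t = (Poly_Mapping.lookup f t when int (total_degree t) = d)"
  by (simp add: hproj_def lookup_mapp when_def in_keys_iff)

lemma hproj_zero [simp]: "hproj d 0 = 0"
  and hproj_add: "hproj d (f + g) = hproj d f + hproj d g"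
  and hproj_diff: "hproj d (f - g) = hproj d f - hproj d g"
  and hproj_sum: "hproj d (sum h A) = (\<Sum>x\<in>A. hproj d (h x))"
  by (auto intro!: poly_mapping_eqI sum.cong simp: lookup_hproj when_def lookup_add lookup_minus
      lookup_sum)

lemma hproj_in: "hproj d f \<in> homogeneous_component d"
  by (auto simp: homogeneous_component_def in_keys_iff lookup_hproj)

lemma hproj_eq: "f \<in> homogeneous_component d \<Longrightarrow> hproj d f = f"
  by (rule poly_mapping_eqI) (auto simp: homogeneous_component_def in_keys_iff lookup_hproj when_def)

text \<open>Multiplication by a monomial of degree e raises every degree by e, and g is a sum of
  such monomials. The factor f stays arbitrary, because the coefficients of vectors and of ideal
  elements are arbitrary.\<close>

lemma hproj_mult:
  assumes g: "g \<in> homogeneous_component e"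
  shows "hproj d (f * g) = hproj (d - e) f * g"
proof -
  have monom: "hproj d (f * monomial t a) = hproj (d - int (total_degree t)) f * monomial t a"
    for t and a :: 'b
  proof (induction f rule: mpoly_induct)
    case (monomial s c)
    have single: "hproj d (monomial s c) = (if int (total_degree s) = d then monomial s c else 0)"
      for d s and c :: 'b
      by (rule poly_mapping_eqI) (auto simp: lookup_hproj lookup_single when_def)
    show ?case by (auto simp: single mult_single total_degree_add)
  qed (simp add: distrib_right hproj_add)
  have "hproj d (f * g)
      = (\<Sum>t\<in>Poly_Mapping.keys g. hproj d (f * monomial t (Poly_Mapping.lookup g t)))"
    by (subst mpoly_eq_sum_monomials[of g]) (simp add: sum_distrib_left hproj_sum)
  also have "\<dots> = (\<Sum>t\<in>Poly_Mapping.keys g. hproj (d - e) f * monomial t (Poly_Mapping.lookup g t))"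
    using g by (intro sum.cong) (auto simp: monom homogeneous_component_def)
  also have "\<dots> = hproj (d - e) f * g"
    by (subst (3) mpoly_eq_sum_monomials[of g]) (simp add: sum_distrib_left)
  finally show ?thesis .
qed

lemma sum_hproj:
  assumes "finite D" "(int \<circ> total_degree) ` Poly_Mapping.keys f \<subseteq> D"
  shows "(\<Sum>d\<in>D. hproj d f) = f"
proof (rule poly_mapping_eqI)
  fix t
  have "(\<Sum>d\<in>D. Poly_Mapping.lookup (hproj d f) t)
      = (\<Sum>d\<in>D. if d = int (total_degree t) then Poly_Mapping.lookup f t else 0)"
    by (rule sum.cong) (auto simp: lookup_hproj when_def)
  then show "Poly_Mapping.lookup (\<Sum>d\<in>D. hproj d f) t = Poly_Mapping.lookup f t"
    using assms by (auto simp: lookup_sum image_subset_iff not_in_keys_iff_lookup_eq_zero[symmetric])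
qed

subsection \<open>Substitution of powers of the variables\<close>

definition exp_scale :: "nat \<Rightarrow> ('n \<Rightarrow>\<^sub>0 nat) \<Rightarrow> 'n \<Rightarrow>\<^sub>0 nat" where
  "exp_scale m = Poly_Mapping.map ((*) m)"

lemma lookup_exp_scale [simp]: "Poly_Mapping.lookup (exp_scale m t) i = m * Poly_Mapping.lookup t i"
  by (simp add: exp_scale_def Poly_Mapping.map.rep_eq when_def)

lemma exp_scale_add: "exp_scale m (s + t) = exp_scale m s + exp_scale m t"
  by (rule poly_mapping_eqI) (simp add: lookup_add distrib_left)

lemma exp_scale_0 [simp]: "exp_scale m 0 = 0"
  by (rule poly_mapping_eqI) simp

lemma exp_scale_eq_0_iff: "m \<noteq> 0 \<Longrightarrow> exp_scale m t = 0 \<longleftrightarrow> t = 0"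
  by (auto simp: poly_mapping_eq_iff fun_eq_iff)

lemma total_degree_exp_scale: "total_degree (exp_scale m t) = m * total_degree t"
  by (simp add: total_degree_def sum_distrib_left)

lemma Var_power: "Var i ^ k = monomial (Poly_Mapping.single i k) (1 :: 'k::field)"
  by (induction k) (simp_all add: Var_def mult_single flip: single_add)

lemma prod_monomial:
  "(\<Prod>i\<in>A. monomial (x i) 1) = monomial (\<Sum>i\<in>A. x i) (1 :: 'k::field)"
  by (induction A rule: infinite_finite_induct) (simp_all add: mult_single)

lemma sum_single_exponent:
  fixes t :: "'n::finite \<Rightarrow>\<^sub>0 nat"
  shows "(\<Sum>i\<in>UNIV. Poly_Mapping.single i (Poly_Mapping.lookup t i)) = t"
  by (rule poly_mapping_eqI) (simp add: lookup_sum lookup_single when_def)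

lemma square_power_poly_monomial:
  "square_power_poly m (monomial t c) = monomial (exp_scale m t) c"
proof -
  have "(Var i ^ m) ^ k = monomial (Poly_Mapping.single i (m * k)) (1 :: 'b)" for i :: 'a and k
    by (metis Var_power power_mult)
  then have "(\<Prod>i\<in>UNIV. (Var i ^ m) ^ Poly_Mapping.lookup t i) = monomial (exp_scale m t) (1 :: 'b)"
    using sum_single_exponent[of "exp_scale m t"] by (simp add: prod_monomial)
  then show ?thesis by (simp add: square_power_poly_def subst_def Const_def mult_single)
qed

text \<open>\<open>subst\<close> sums over the support, which changes under addition. The summand is
  additive in the coefficient and vanishes at coefficient 0, so the sums still add up.\<close>

lemma square_power_poly_add:
  "square_power_poly m (f + g) = square_power_poly m f + square_power_poly m g"
  unfolding square_power_poly_def subst_def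
  by (rule setsum_keys_plus_distrib) (simp_all add: Const_def single_add distrib_right)

lemma square_power_poly_0 [simp]: "square_power_poly m 0 = 0"
  by (simp add: square_power_poly_def subst_def)

lemma square_power_poly_1 [simp]: "square_power_poly m 1 = 1"
  using square_power_poly_monomial[of m 0 1] by simp

lemma square_power_poly_diff:
  "square_power_poly m (f - g) = square_power_poly m f - square_power_poly m g"
  using square_power_poly_add[of m "f - g" g] by simp

lemma square_power_poly_sum:
  "square_power_poly m (sum h A) = (\<Sum>x\<in>A. square_power_poly m (h x))"
  by (induction A rule: infinite_finite_induct) (simp_all add: square_power_poly_add)

lemma square_power_poly_mult:
  "square_power_poly m (f * g) = square_power_poly m f * square_power_poly m g"
proof (induction f rule: mpoly_induct)
  case (monomial s a)
  show ?case
    by (induction g rule: mpoly_induct)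
      (simp_all add: mult_single square_power_poly_monomial exp_scale_add distrib_left
        square_power_poly_add)
qed (simp add: distrib_right square_power_poly_add)

text \<open>For nonzero m no other monomial is moved to exponent 0. This is what leaves the complex
  tensored with K unchanged.\<close>

lemma const_coeff_square_power_poly:
  "m \<noteq> 0 \<Longrightarrow> const_coeff (square_power_poly m f) = const_coeff f"
  by (induction f rule: mpoly_induct)
    (auto simp: square_power_poly_monomial square_power_poly_add const_coeff_def lookup_add
      lookup_single when_def exp_scale_eq_0_iff)

lemma square_power_poly_homogeneous:
  assumes "f \<in> homogeneous_component d"
  shows "square_power_poly m f \<in> homogeneous_component (int m * d)"
proof -
  have "square_power_poly m f = (\<Sum>t\<in>Poly_Mapping.keys f.
      monomial (exp_scale m t) (Poly_Mapping.lookup f t))"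
    by (subst mpoly_eq_sum_monomials[of f])
      (simp add: square_power_poly_sum square_power_poly_monomial)
  moreover have "monomial (exp_scale m t) (Poly_Mapping.lookup f t)
      \<in> homogeneous_component (int m * d)" if "t \<in> Poly_Mapping.keys f" for t
    using assms that by (auto simp: homogeneous_component_def total_degree_exp_scale)
  ultimately show ?thesis by (simp add: homogeneous_component_sum)
qed

text \<open>
  \<open>coordinate m a f\<close> is the coefficient of \<open>X\<^sup>a\<close> in the expansion of \<open>f\<close> over the image of the
  substitution, pulled back along it.
\<close>

definition reduced_exponents :: "nat \<Rightarrow> ('n::finite \<Rightarrow>\<^sub>0 nat) set" where
  "reduced_exponents m = {a. \<forall>i. Poly_Mapping.lookup a i < m}"

definition coordinate :: "nat \<Rightarrow> ('n::finite \<Rightarrow>\<^sub>0 nat) \<Rightarrow> ('n, 'k::field) mpoly \<Rightarrow> ('n, 'k) mpoly" where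
  "coordinate m a = Poly_Mapping.map_key (\<lambda>t. a + exp_scale m t)"

lemma finite_reduced_exponents: "finite (reduced_exponents m :: ('n::finite \<Rightarrow>\<^sub>0 nat) set)"
proof -
  have "Poly_Mapping.lookup ` (reduced_exponents m :: ('n \<Rightarrow>\<^sub>0 nat) set)
      \<subseteq> {f. \<forall>i. (i \<in> UNIV \<longrightarrow> f i \<in> {..<m}) \<and> (i \<notin> UNIV \<longrightarrow> f i = 0)}"
    by (auto simp: reduced_exponents_def)
  then have "finite (Poly_Mapping.lookup ` (reduced_exponents m :: ('n \<Rightarrow>\<^sub>0 nat) set))"
    by (rule finite_subset) (rule finite_set_of_finite_funs; simp)
  then show ?thesis by (rule finite_imageD) (simp add: inj_on_def)
qed

lemma inj_reduced_exponents_add: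
  assumes "m \<noteq> 0"
  shows "inj (\<lambda>t. a + exp_scale m t)"
  using assms by (auto intro!: injI simp: poly_mapping_eq_iff fun_eq_iff lookup_add)

lemma coordinate_add: "m \<noteq> 0 \<Longrightarrow> coordinate m a (f + g) = coordinate m a f + coordinate m a g"
  by (simp add: coordinate_def map_key_plus inj_reduced_exponents_add)

lemma coordinate_0 [simp]: "m \<noteq> 0 \<Longrightarrow> coordinate m a 0 = 0"
  by (simp add: coordinate_def map_key_zero inj_reduced_exponents_add)

lemma coordinate_sum:
  "m \<noteq> 0 \<Longrightarrow> coordinate m a (sum h A) = (\<Sum>x\<in>A. coordinate m a (h x))"
  by (induction A rule: infinite_finite_induct) (simp_all add: coordinate_add)

lemma lookup_coordinate:
  "m \<noteq> 0 \<Longrightarrow> Poly_Mapping.lookup (coordinate m a f) t = Poly_Mapping.lookup f (a + exp_scale m t)"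
  by (simp add: coordinate_def inj_reduced_exponents_add map_key.rep_eq)

lemma exponent_decomposition:
  fixes s :: "'n::finite \<Rightarrow>\<^sub>0 nat"
  assumes "m \<noteq> 0"
  obtains a u where "a \<in> reduced_exponents m" "s = a + exp_scale m u"
proof
  \<comment> \<open>Remainder and quotient of each exponent by m. The variables form a finite type,
    so every exponent function has finite support.\<close>
  define a u where "a = Abs_poly_mapping (\<lambda>i. Poly_Mapping.lookup s i mod m)"
    and "u = Abs_poly_mapping (\<lambda>i. Poly_Mapping.lookup s i div m)"
  show "a \<in> reduced_exponents m" using assms by (simp add: a_def reduced_exponents_def)
  show "s = a + exp_scale m u"
    by (rule poly_mapping_eqI) (simp add: a_def u_def lookup_add)
qed

lemma exponent_decomposition_unique:
  assumes "a \<in> reduced_exponents m" "b \<in> reduced_exponents m"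
    and "a + exp_scale m u = b + exp_scale m v"
  shows "a = b \<and> u = v"
proof -
  have "Poly_Mapping.lookup a i = Poly_Mapping.lookup b i \<and>
      Poly_Mapping.lookup u i = Poly_Mapping.lookup v i" for i
  proof -
    have lt: "Poly_Mapping.lookup a i < m" "Poly_Mapping.lookup b i < m"
      using assms(1,2) by (auto simp: reduced_exponents_def)
    have eq: "Poly_Mapping.lookup a i + m * Poly_Mapping.lookup u i
        = Poly_Mapping.lookup b i + m * Poly_Mapping.lookup v i"
      using assms(3) by (metis lookup_add lookup_exp_scale)
    have "(Poly_Mapping.lookup a i + m * Poly_Mapping.lookup u i) mod m
        = (Poly_Mapping.lookup b i + m * Poly_Mapping.lookup v i) mod m"
      using eq by simp
    with lt have "Poly_Mapping.lookup a i = Poly_Mapping.lookup b i" by simp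
    with eq lt show ?thesis by simp
  qed
  then show ?thesis by (simp add: poly_mapping_eq_iff fun_eq_iff)
qed

lemma coordinate_monomial:
  assumes "a \<in> reduced_exponents m" "b \<in> reduced_exponents m" "m \<noteq> 0"
  shows "coordinate m a (monomial (b + exp_scale m u) c) = (if a = b then monomial u c else 0)"
proof (rule poly_mapping_eqI)
  fix t
  have "b + exp_scale m u = a + exp_scale m t \<longleftrightarrow> a = b \<and> u = t"
    using exponent_decomposition_unique[OF assms(2,1), of u t] by auto
  then show "Poly_Mapping.lookup (coordinate m a (monomial (b + exp_scale m u) c)) t
      = Poly_Mapping.lookup (if a = b then monomial u c else 0) t"
    using assms(3) by (auto simp: lookup_coordinate lookup_single when_def)
qed

text \<open>Multiplying by a monomial in the m-th powers changes the quotients of the exponents by m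
  but not the remainders, so coordinates are linear over the image of the substitution.\<close>

lemma coordinate_mult:
  assumes a: "a \<in> reduced_exponents m" and m: "m \<noteq> 0"
  shows "coordinate m a (square_power_poly m g * f) = g * coordinate m a f"
proof (induction g rule: mpoly_induct)
  case (monomial t c)
  show ?case
  proof (induction f rule: mpoly_induct)
    case (monomial s d)
    obtain b u where b: "b \<in> reduced_exponents m" and s: "s = b + exp_scale m u"
      using exponent_decomposition[OF m] by blast
    have "exp_scale m t + s = b + exp_scale m (t + u)"
      by (simp add: s exp_scale_add ac_simps)
    then show ?case
      by (simp add: square_power_poly_monomial mult_single s coordinate_monomial[OF a b m])
  qed (simp add: coordinate_add m distrib_left)
qed (simp add: coordinate_add m distrib_right square_power_poly_add)

text \<open>The spanning half of freeness over the image of the substitution;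
  \<open>coordinate_monomial\<close> supplies the independence half.\<close>

lemma sum_coordinates:
  assumes m: "m \<noteq> 0"
  shows "(\<Sum>a\<in>reduced_exponents m. monomial a 1 * square_power_poly m (coordinate m a f)) = f"
proof (induction f rule: mpoly_induct)
  case (monomial s c)
  obtain b u where b: "b \<in> reduced_exponents m" and s: "s = b + exp_scale m u"
    using exponent_decomposition[OF m] by blast
  have "(\<Sum>a\<in>reduced_exponents m. monomial a 1 * square_power_poly m (coordinate m a (monomial s c)))
      = (\<Sum>a\<in>reduced_exponents m. if a = b then monomial s c else 0)"
    using b m
    by (intro sum.cong)
      (auto simp: s coordinate_monomial square_power_poly_monomial mult_single)
  then show ?case using b by (simp add: finite_reduced_exponents)
qed (simp add: coordinate_add m square_power_poly_add distrib_left sum.distrib)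

section \<open>Graded free modules\<close>

text \<open>Used over the polynomial ring and over \<open>'k\<close>; in the second case it is the
  scalar multiplication for which \<open>tor_dim\<close> takes dimensions.\<close>

definition vscale :: "'a::comm_ring_1 \<Rightarrow> (nat \<Rightarrow> 'a) \<Rightarrow> nat \<Rightarrow> 'a" where
  "vscale a v = (\<lambda>b. a * v b)"

lemma vscale_apply [simp]: "vscale a v b = a * v b"
  by (simp add: vscale_def)

interpretation vec: module "vscale :: 'a::comm_ring_1 \<Rightarrow> _"
  by unfold_locales (simp_all add: fun_eq_iff algebra_simps)

abbreviation vec_linear :: "((nat \<Rightarrow> 'a::comm_ring_1) \<Rightarrow> nat \<Rightarrow> 'a) \<Rightarrow> bool" where
  "vec_linear \<equiv> module_hom vscale vscale"

lemma vec_linearI: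
  assumes "\<And>x y. f (x + y) = f x + f y" "\<And>a x. f (vscale a x) = vscale a (f x)"
  shows "vec_linear f"
  using assms by unfold_locales auto

lemma sum_vec_apply: "(\<Sum>x\<in>A. f x) (b :: nat) = (\<Sum>x\<in>A. f x b :: 'a::comm_monoid_add)"
  by (induction A rule: infinite_finite_induct) simp_all

definition unit_vec :: "nat \<Rightarrow> nat \<Rightarrow> 'a::zero_neq_one" where
  "unit_vec b = (\<lambda>c. if c = b then 1 else 0)"

lemma subspace_free_module: "vec.subspace (free_module r)"
  by (auto intro!: vec.subspaceI simp: free_module_def)

lemma free_module_zero [simp]: "(0 :: nat \<Rightarrow> 'a::comm_ring_1) \<in> free_module r"
  by (simp add: free_module_def)

lemma unit_vec_in_free_module: "b < r \<Longrightarrow> unit_vec b \<in> free_module r"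
  by (auto simp: unit_vec_def free_module_def)

lemma free_module_expansion:
  fixes v :: "nat \<Rightarrow> 'a::comm_ring_1"
  assumes "v \<in> free_module r"
  shows "v = (\<Sum>b<r. vscale (v b) (unit_vec b))"
proof
  fix c
  have "(\<Sum>b<r. v b * unit_vec b c) = (\<Sum>b<r. if b = c then v c else 0)"
    by (rule sum.cong) (auto simp: unit_vec_def)
  then show "v c = (\<Sum>b<r. vscale (v b) (unit_vec b)) c"
    using assms by (simp add: sum_vec_apply free_module_def)
qed

text \<open>Maps are defined on all functions on \<open>nat\<close>, where unit vectors do not
  determine them. This is why later equations between maps are restricted to free modules of finite
  rank.\<close>

lemma vec_linear_expansion:
  assumes "vec_linear f" "v \<in> free_module r"
  shows "f v = (\<Sum>b<r. vscale (v b) (f (unit_vec b)))"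
proof -
  interpret f: module_hom vscale vscale f by fact
  have "f v = f (\<Sum>b<r. vscale (v b) (unit_vec b))"
    using free_module_expansion[OF assms(2)] by simp
  then show ?thesis by (simp add: f.sum f.scale)
qed

text \<open>The linear map whose matrix has the columns \<open>w b\<close>; entries of v from r on
  are ignored.\<close>

definition lin_comb :: "nat \<Rightarrow> (nat \<Rightarrow> nat \<Rightarrow> 'a::comm_ring_1) \<Rightarrow> (nat \<Rightarrow> 'a) \<Rightarrow> nat \<Rightarrow> 'a" where
  "lin_comb r w v = (\<Sum>b<r. vscale (v b) (w b))"

lemma vec_linear_lin_comb: "vec_linear (lin_comb r w)"
  by (rule vec_linearI)
    (auto simp: lin_comb_def fun_eq_iff sum_vec_apply distrib_right sum.distrib sum_distrib_left
      mult.assoc)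

lemma lin_comb_unit_vec: "b < r \<Longrightarrow> lin_comb r w (unit_vec b) = w b"
proof
  fix c
  assume b: "b < r"
  have "(\<Sum>x<r. unit_vec b x * w x c) = (\<Sum>x<r. if x = b then w b c else 0)"
    by (rule sum.cong) (auto simp: unit_vec_def)
  with b show "lin_comb r w (unit_vec b) c = w b c"
    by (simp add: lin_comb_def sum_vec_apply)
qed

lemma lin_comb_in_subspace:
  assumes "vec.subspace M" "\<And>b. b < r \<Longrightarrow> w b \<in> M"
  shows "lin_comb r w v \<in> M"
  unfolding lin_comb_def using assms by (auto intro!: vec.subspace_sum vec.subspace_scale)

lemma range_lin_comb: "lin_comb r w ` free_module r = vec.span (w ` {..<r})"
proof (rule vec.span_unique[symmetric])
  show "w ` {..<r} \<subseteq> lin_comb r w ` free_module r"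
    by (metis image_subsetI imageI lessThan_iff lin_comb_unit_vec unit_vec_in_free_module)
  show "vec.subspace (lin_comb r w ` free_module r)"
    by (rule module_hom.subspace_image[OF vec_linear_lin_comb subspace_free_module])
  show "lin_comb r w ` free_module r \<subseteq> T" if "w ` {..<r} \<subseteq> T" "vec.subspace T" for T
    using that by (auto intro!: lin_comb_in_subspace)
qed

text \<open>Matrix entries in rows from \<open>r i\<close> on are unconstrained. The conditional
  cuts them off, so that the columns lie in the free module of rank \<open>r i\<close>.\<close>

lemma differential_Suc:
  "differential r A (Suc i)
    = lin_comb (r (Suc i)) (\<lambda>b c. if c < r i then A (Suc i) c b else 0)"
  by (auto simp: fun_eq_iff differential_def lin_comb_def sum_vec_apply mult.commute)

section \<open>Homogeneous parts and degree-0 maps of the shifted modules, the direct sums of the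
  R(-\<delta> b)\<close>

definition hvec :: "nat \<Rightarrow> (nat \<Rightarrow> int) \<Rightarrow> int \<Rightarrow> (nat \<Rightarrow> ('n::finite, 'k::field) mpoly) set" where
  "hvec r \<delta> j = {v \<in> free_module r. \<forall>b. v b \<in> homogeneous_component (j - \<delta> b)}"

definition hvproj :: "(nat \<Rightarrow> int) \<Rightarrow> int \<Rightarrow> (nat \<Rightarrow> ('n::finite, 'k::field) mpoly) \<Rightarrow> nat \<Rightarrow> ('n, 'k) mpoly" where
  "hvproj \<delta> j v = (\<lambda>b. hproj (j - \<delta> b) (v b))"

lemma hvproj_zero [simp]: "hvproj \<delta> j 0 = 0"
  and hvproj_diff: "hvproj \<delta> j (v - w) = hvproj \<delta> j v - hvproj \<delta> j w"
  by (simp_all add: hvproj_def fun_eq_iff hproj_diff)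

lemma hvproj_eq: "v \<in> hvec r \<delta> j \<Longrightarrow> hvproj \<delta> j v = v"
  by (simp add: hvec_def hvproj_def hproj_eq)

lemma hvproj_in: "v \<in> free_module r \<Longrightarrow> hvproj \<delta> j v \<in> hvec r \<delta> j"
  by (simp add: hvproj_def hvec_def free_module_def hproj_in)

lemma unit_vec_in_hvec: "b < r \<Longrightarrow> unit_vec b \<in> hvec r \<delta> (\<delta> b)"
  using homogeneous_component_one
  by (auto simp: hvec_def unit_vec_in_free_module) (auto simp: unit_vec_def)

lemma hvec_add: "v \<in> hvec r \<delta> j \<Longrightarrow> w \<in> hvec r \<delta> j \<Longrightarrow> v + w \<in> hvec r \<delta> j"
  and hvec_uminus: "v \<in> hvec r \<delta> j \<Longrightarrow> - v \<in> hvec r \<delta> j"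
  by (auto simp: hvec_def free_module_def homogeneous_component_add homogeneous_component_uminus)

lemma hvec_diff: "v \<in> hvec r \<delta> j \<Longrightarrow> w \<in> hvec r \<delta> j \<Longrightarrow> v - w \<in> hvec r \<delta> j"
  using hvec_add[OF _ hvec_uminus] by fastforce

text \<open>Homogeneity of degree 0 is required on basis vectors only, where matrices provide it;
  \<open>graded_map_hvec\<close> extends it to all homogeneous vectors.\<close>

definition graded_map ::
  "nat \<Rightarrow> (nat \<Rightarrow> int) \<Rightarrow> nat \<Rightarrow> (nat \<Rightarrow> int) \<Rightarrow>
    ((nat \<Rightarrow> ('n::finite, 'k::field) mpoly) \<Rightarrow> nat \<Rightarrow> ('n, 'k) mpoly) \<Rightarrow> bool" where
  "graded_map r \<delta> s \<epsilon> f \<longleftrightarrow>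
    vec_linear f \<and> (\<forall>b<r. f (unit_vec b) \<in> hvec s \<epsilon> (\<delta> b))"

lemma graded_map_linear: "graded_map r \<delta> s \<epsilon> f \<Longrightarrow> vec_linear f"
  by (simp add: graded_map_def)

lemmas graded_map_diff = module_hom.diff[OF graded_map_linear]
  and graded_map_zero = module_hom.zero[OF graded_map_linear]

lemma graded_map_free:
  assumes f: "graded_map r \<delta> s \<epsilon> f" and v: "v \<in> free_module r"
  shows "f v \<in> free_module s"
  unfolding vec_linear_expansion[OF graded_map_linear[OF f] v]
  using f by (auto intro!: vec.subspace_sum vec.subspace_scale subspace_free_module
      simp: graded_map_def hvec_def)

text \<open>The matrix entry in row c and column b is homogeneous of degree
  \<open>\<delta> b - \<epsilon> c\<close>, so by \<open>hproj_mult\<close> taking the part of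
  degree \<open>j - \<epsilon> c\<close> after multiplication is taking the part of degree
  \<open>j - \<delta> b\<close> before it.\<close>

lemma graded_map_hvproj:
  assumes f: "graded_map r \<delta> s \<epsilon> f" and v: "v \<in> free_module r"
  shows "f (hvproj \<delta> j v) = hvproj \<epsilon> j (f v)"
proof -
  have hv: "hvproj \<delta> j v \<in> free_module r" using v by (simp add: hvproj_def free_module_def)
  have "hproj (j - \<epsilon> c) (v b * f (unit_vec b) c) = hproj (j - \<delta> b) (v b) * f (unit_vec b) c"
    if "b < r" for b c
    using f that hproj_mult[of "f (unit_vec b) c" "\<delta> b - \<epsilon> c" "j - \<epsilon> c"]
    by (auto simp: graded_map_def hvec_def)
  then have "(\<Sum>b<r. hproj (j - \<delta> b) (v b) * f (unit_vec b) c)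
      = (\<Sum>b<r. hproj (j - \<epsilon> c) (v b * f (unit_vec b) c))" for c
    by (intro sum.cong refl) simp
  then show ?thesis
    using vec_linear_expansion[OF graded_map_linear[OF f] v]
      vec_linear_expansion[OF graded_map_linear[OF f] hv]
    by (simp add: fun_eq_iff sum_vec_apply hvproj_def hproj_sum)
qed

lemma graded_map_hvec:
  assumes f: "graded_map r \<delta> s \<epsilon> f" and v: "v \<in> hvec r \<delta> j"
  shows "f v \<in> hvec s \<epsilon> j"
proof -
  have "v \<in> free_module r" using v by (simp add: hvec_def)
  then show ?thesis
    using graded_map_hvproj[OF f, of v j] hvproj_in[OF graded_map_free[OF f], of v \<epsilon> j] hvproj_eq[OF v]
    by simp
qed

lemma graded_map_compose:
  assumes f: "graded_map r \<delta> s \<epsilon> f" and g: "graded_map s \<epsilon> t \<zeta> g"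
  shows "graded_map r \<delta> t \<zeta> (\<lambda>v. g (f v))"
proof -
  interpret f: module_hom vscale vscale f by (rule graded_map_linear[OF f])
  interpret g: module_hom vscale vscale g by (rule graded_map_linear[OF g])
  have "vec_linear (\<lambda>v. g (f v))"
    by (rule vec_linearI) (simp_all add: f.add f.scale g.add g.scale)
  then show ?thesis using f graded_map_hvec[OF g] by (simp add: graded_map_def)
qed

lemma graded_map_minus:
  assumes f: "graded_map r \<delta> s \<epsilon> f" and g: "graded_map r \<delta> s \<epsilon> g"
  shows "graded_map r \<delta> s \<epsilon> (\<lambda>v. f v - g v)"
proof -
  interpret f: module_hom vscale vscale f by (rule graded_map_linear[OF f])
  interpret g: module_hom vscale vscale g by (rule graded_map_linear[OF g])
  have "vec_linear (\<lambda>v. f v - g v)"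
    by (rule vec_linearI)
      (simp_all add: f.add f.scale g.add g.scale vec.scale_right_diff_distrib)
  then show ?thesis using f g by (auto simp: graded_map_def hvec_diff)
qed

lemma graded_map_id: "graded_map r \<delta> r \<delta> (\<lambda>v. v)"
  by (auto simp: graded_map_def unit_vec_in_hvec intro: vec_linearI)

lemma graded_map_0: "graded_map r \<delta> s \<epsilon> (\<lambda>v. 0)"
  by (auto simp: graded_map_def hvec_def intro: vec_linearI)

lemma graded_map_lin_comb:
  "(\<And>b. b < r \<Longrightarrow> w b \<in> hvec s \<epsilon> (\<delta> b)) \<Longrightarrow> graded_map r \<delta> s \<epsilon> (lin_comb r w)"
  by (simp add: graded_map_def vec_linear_lin_comb lin_comb_unit_vec)

text \<open>Closure under homogeneous parts, rather than generation by homogeneous elements: in this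
  form the property passes directly to preimages and kernels. Homogeneous generators are recovered
  in \<open>graded_submodule_generators\<close>.\<close>

definition graded_submodule ::
  "nat \<Rightarrow> (nat \<Rightarrow> int) \<Rightarrow> (nat \<Rightarrow> ('n::finite, 'k::field) mpoly) set \<Rightarrow> bool" where
  "graded_submodule r \<delta> M \<longleftrightarrow>
    vec.subspace M \<and> M \<subseteq> free_module r \<and> (\<forall>v\<in>M. \<forall>j. hvproj \<delta> j v \<in> M)"

lemma graded_submodule_vimage:
  assumes f: "graded_map r \<delta> s \<epsilon> f" and N: "graded_submodule s \<epsilon> N"
  shows "graded_submodule r \<delta> {v \<in> free_module r. f v \<in> N}"
proof -
  have "vec.subspace (free_module r \<inter> f -` N)"
    using module_hom.subspace_vimage[OF graded_map_linear[OF f]] N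
    by (auto simp: graded_submodule_def intro: vec.subspace_inter subspace_free_module)
  moreover have "free_module r \<inter> f -` N = {v \<in> free_module r. f v \<in> N}" by auto
  moreover have "hvproj \<delta> j v \<in> free_module r" if "v \<in> free_module r" for v j
    using hvproj_in[OF that] by (simp add: hvec_def)
  ultimately show ?thesis
    using N by (auto simp: graded_submodule_def graded_map_hvproj[OF f])
qed

lemma graded_submodule_0: "graded_submodule r \<delta> {0}"
  by (simp add: graded_submodule_def)

text \<open>Graded free modules are projective, here modulo N. A preimage of each basis vector
  exists by assumption; its part of the right degree is again a preimage, because the error stays in
  N under projection.\<close>

lemma graded_lift:
  assumes d: "graded_map t \<zeta> s \<epsilon> d" and f: "graded_map r \<delta> s \<epsilon> f"
    and N: "graded_submodule s \<epsilon> N"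
    and ex: "\<And>b. b < r \<Longrightarrow> \<exists>w\<in>free_module t. d w - f (unit_vec b) \<in> N"
  obtains g where "graded_map r \<delta> t \<zeta> g" "\<And>v. v \<in> free_module r \<Longrightarrow> d (g v) - f v \<in> N"
proof -
  have "\<exists>w\<in>hvec t \<zeta> (\<delta> b). d w - f (unit_vec b) \<in> N" if b: "b < r" for b
  proof -
    obtain w where w: "w \<in> free_module t" "d w - f (unit_vec b) \<in> N" using ex[OF b] by blast
    have "hvproj \<epsilon> (\<delta> b) (f (unit_vec b)) = f (unit_vec b)"
      using f b by (auto simp: graded_map_def intro: hvproj_eq)
    then have "d (hvproj \<zeta> (\<delta> b) w) - f (unit_vec b) = hvproj \<epsilon> (\<delta> b) (d w - f (unit_vec b))"
      by (simp add: graded_map_hvproj[OF d w(1)] hvproj_diff)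
    then show ?thesis
      using w N hvproj_in[OF w(1)] by (metis graded_submodule_def)
  qed
  then obtain w where w: "\<And>b. b < r \<Longrightarrow> w b \<in> hvec t \<zeta> (\<delta> b)"
    "\<And>b. b < r \<Longrightarrow> d (w b) - f (unit_vec b) \<in> N"
    by metis
  let ?g = "lin_comb r w"
  have g: "graded_map r \<delta> t \<zeta> ?g" using w(1) by (rule graded_map_lin_comb)
  have h: "graded_map r \<delta> s \<epsilon> (\<lambda>v. d (?g v) - f v)"
    by (intro graded_map_minus graded_map_compose[OF g d] f)
  have "d (?g v) - f v \<in> N" if v: "v \<in> free_module r" for v
    unfolding vec_linear_expansion[OF graded_map_linear[OF h] v]
    using N w(2)
    by (auto simp: graded_submodule_def lin_comb_unit_vec intro!: vec.subspace_sum vec.subspace_scale)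
  with g show ?thesis using that by blast
qed

text \<open>If x is a homogeneous generator, every homogeneous part of a multiple of x is again a
  multiple of x.\<close>

lemma hproj_in_homogeneous_ideal:
  assumes I: "homogeneous_ideal I" and f: "f \<in> I"
  shows "hproj d f \<in> I"
proof -
  interpret R: module "(*) :: ('a, 'b) mpoly \<Rightarrow> _" by (rule module_mult)
  obtain G where G: "G \<subseteq> (\<Union>d. homogeneous_component d)" and IG: "I = R.span G"
    using I by (auto simp: homogeneous_ideal_def ideal_generated_def)
  have "f \<in> R.span G" using f IG by simp
  then have "hproj d f \<in> R.span G"
  proof (induction rule: R.span_induct_alt)
    case (step c x y)
    obtain e where "x \<in> homogeneous_component e" using G step by blast
    then have "hproj d (c * x + y) = hproj (d - e) c * x + hproj d y"
      by (simp add: hproj_add hproj_mult)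
    then show ?case using step by (simp add: R.span_add R.span_base R.span_scale)
  qed (simp add: R.span_zero)
  then show ?thesis using IG by simp
qed

definition ideal_vecs :: "'a::comm_ring_1 set \<Rightarrow> (nat \<Rightarrow> 'a) set" where
  "ideal_vecs I = {v \<in> free_module 1. v 0 \<in> I}"

lemma graded_submodule_ideal_vecs:
  assumes I: "homogeneous_ideal I"
  shows "graded_submodule 1 (\<lambda>_. 0) (ideal_vecs I)"
proof -
  interpret R: module "(*) :: ('a, 'b) mpoly \<Rightarrow> _" by (rule module_mult)
  have "R.subspace I" using I by (simp add: homogeneous_ideal_def ideal_def)
  then show ?thesis
    using hproj_in_homogeneous_ideal[OF I]
    by (auto simp: graded_submodule_def ideal_vecs_def vec.subspace_def free_module_def hvproj_def
        R.subspace_0 R.subspace_add R.subspace_scale)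
qed

section \<open>Finite generation and existence of resolutions\<close>

lemma incseq_subseq_nat:
  fixes s :: "nat \<Rightarrow> nat"
  obtains g where "strict_mono g" "incseq (\<lambda>n. s (g n))"
proof -
  obtain h where h: "strict_mono h" "monoseq (\<lambda>n. s (h n))"
    using seq_monosub by blast
  show ?thesis
  proof (cases "incseq (\<lambda>n. s (h n))")
    case False
    then have dec: "decseq (\<lambda>n. s (h n))" using h(2) by (auto simp: monoseq_iff)
    \<comment> \<open>A non-increasing sequence of natural numbers is constant from the place where
      it attains its minimum, and a constant tail is non-decreasing.\<close>
    obtain N where N: "\<And>n. s (h N) \<le> s (h n)"
      using ex_has_least_nat[of "\<lambda>_. True" 0 "\<lambda>n. s (h n)"] by auto
    have "s (h (N + n)) = s (h N)" for n
      using N dec by (metis decseqD le_add1 le_antisym)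
    moreover have "strict_mono (\<lambda>n. h (N + n))"
      using h(1) by (auto simp: strict_mono_def)
    ultimately show ?thesis using that[of "\<lambda>n. h (N + n)"] by (simp add: incseq_def)
  qed (use h that in blast)
qed

text \<open>One coordinate function is treated at a time: passing to a further subsequence keeps the
  monotonicity already obtained.\<close>

lemma incseq_subseq_finite:
  fixes C :: "('a \<Rightarrow> nat) set" and x :: "nat \<Rightarrow> 'a"
  assumes "finite C"
  shows "\<exists>g. strict_mono g \<and> (\<forall>c\<in>C. incseq (\<lambda>n. c (x (g n))))"
  using assms
proof induction
  case empty
  show ?case by (auto intro: exI[of _ id] strict_mono_id)
next
  case (insert c C)
  then obtain g where g: "strict_mono g" "\<And>c. c \<in> C \<Longrightarrow> incseq (\<lambda>n. c (x (g n)))" by blast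
  obtain h where h: "strict_mono h" "incseq (\<lambda>n. c (x (g (h n))))"
    by (rule incseq_subseq_nat[of "\<lambda>n. c (x (g n))"])
  have "incseq (\<lambda>n. c (x (g (h n))))" if "c \<in> C" for c
    using g(2)[OF that] strict_mono_mono[OF h(1)] by (simp add: incseq_def mono_def)
  moreover have "strict_mono (\<lambda>n. g (h n))" using g(1) h(1) by (simp add: strict_mono_def)
  ultimately show ?case using h(2) by auto
qed

text \<open>
  The weight is a product of powers of distinct primes; comparing weights is a well-order on the
  monomials \<open>X\<^sup>t e\<^sub>b\<close> that is compatible with multiplication.
\<close>

lemma monomial_weight:
  fixes r :: nat
  obtains \<kappa> :: "nat \<times> ('n::finite \<Rightarrow>\<^sub>0 nat) \<Rightarrow> nat" and \<phi> :: "('n \<Rightarrow>\<^sub>0 nat) \<Rightarrow> nat"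
  where "inj_on \<kappa> ({..<r} \<times> UNIV)" "\<And>b s t. \<kappa> (b, s + t) = \<phi> s * \<kappa> (b, t)" 
proof -
  obtain p :: "nat \<Rightarrow> nat" where p: "inj p" "range p \<subseteq> {p. prime p}"
    using infinite_countable_subset[OF primes_infinite] by blast
  obtain N and e :: "'n \<Rightarrow> nat" where e: "e ` UNIV = {i. i < N}" "inj e"
    using finite_imp_inj_to_nat_seg[OF finite_UNIV] by blast
  define u where "u = inv e"
  \<comment> \<open>Slots below N hold the exponents of the variables. The r slots from N on encode
    the index of the basis vector by a single 1, so that their primes separate the basis
    vectors.\<close>
  define E :: "nat \<times> ('n \<Rightarrow>\<^sub>0 nat) \<Rightarrow> nat \<Rightarrow> nat" where
    "E x k = (if k < N then Poly_Mapping.lookup (snd x) (u k) else of_bool (k = N + fst x))" for x k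
  define \<kappa> where "\<kappa> x = (\<Prod>k<N + r. p k ^ E x k)" for x
  \<comment> \<open>Multiplication by a monomial does not touch the index of the basis vector; hence
    exponent 0 in the slots from N on.\<close>
  define \<phi> where "\<phi> s = (\<Prod>k<N + r. p k ^ (if k < N then Poly_Mapping.lookup s (u k) else 0))"
    for s :: "'n \<Rightarrow>\<^sub>0 nat"
  have mult: "multiplicity (p k) (\<kappa> x) = E x k" if "k < N + r" for x k
  proof -
    have "\<kappa> x = (\<Prod>q\<in>p ` {..<N + r}. q ^ E x (inv p q))"
      using p(1) by (subst prod.reindex) (auto simp: \<kappa>_def inj_on_def)
    then show ?thesis
      using multiplicity_prod_prime_powers[of "p ` {..<N + r}" "p k" "\<lambda>q. E x (inv p q)"] p that
      by auto
  qed
  have "x = y" if x: "fst x < r" and y: "fst y < r" and eq: "\<kappa> x = \<kappa> y" for x y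
  proof -
    have E: "E x k = E y k" if "k < N + r" for k using mult[OF that] eq by metis
    have "of_bool (fst x = fst y) = (1 :: nat)" using E[of "N + fst x"] x by (simp add: E_def)
    then have "fst x = fst y" by (metis of_bool_eq_1_iff)
    moreover have "Poly_Mapping.lookup (snd x) i = Poly_Mapping.lookup (snd y) i" for i
    proof -
      have "e i < N" using e(1) by auto
      then show ?thesis using E[of "e i"] e(2) by (simp add: E_def u_def)
    qed
    ultimately show ?thesis by (simp add: prod_eq_iff poly_mapping_eqI)
  qed
  then have "inj_on \<kappa> ({..<r} \<times> UNIV)" by (auto intro!: inj_onI)
  moreover have "\<kappa> (b, s + t) = \<phi> s * \<kappa> (b, t)" for b s t
    unfolding \<kappa>_def \<phi>_def prod.distrib[symmetric]
    by (rule prod.cong) (auto simp: E_def lookup_add power_add)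
  ultimately show ?thesis using that by blast
qed

lemma exponent_add_diff:
  fixes s t :: "'n \<Rightarrow>\<^sub>0 nat"
  assumes "\<And>i. Poly_Mapping.lookup s i \<le> Poly_Mapping.lookup t i"
  shows "(t - s) + s = t"
  using assms by (intro poly_mapping_eqI) (simp add: lookup_add lookup_minus)

text \<open>
  In a submodule that is not finitely generated, pick successively elements of minimal leading
  weight outside the span of the previous ones. By Dickson's lemma some leading monomial divides a
  later one, and cancelling the latter contradicts minimality.
\<close>

lemma submodule_finitely_generated:
  fixes M :: "(nat \<Rightarrow> ('n::finite, 'k::field) mpoly) set"
  assumes M: "vec.subspace M" and free: "M \<subseteq> free_module r"
  obtains S where "finite S" "S \<subseteq> M" "vec.span S = M"
proof (rule ccontr)
  note generators = that
  assume no: "\<not> thesis"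
  have not_fg: "vec.span S \<noteq> M" if "finite S" "S \<subseteq> M" for S
    using no by (rule contrapos_nn) (rule generators[OF that])
  obtain \<kappa> :: "nat \<times> ('n \<Rightarrow>\<^sub>0 nat) \<Rightarrow> nat" and \<phi>
    where inj: "inj_on \<kappa> ({..<r} \<times> UNIV)" and mult: "\<And>b s t. \<kappa> (b, s + t) = \<phi> s * \<kappa> (b, t)"
    using monomial_weight[of r] by blast
  define supp where "supp v = {x. snd x \<in> Poly_Mapping.keys (v (fst x))}"
    for v :: "nat \<Rightarrow> ('n, 'k) mpoly"
  \<comment> \<open>The leading weight, meaningful for nonzero v in M: then the support is finite
    and nonempty.\<close>
  define \<mu> where "\<mu> v = Max (\<kappa> ` supp v)" for v
  have supp_bound: "fst x < r" if "v \<in> M" "x \<in> supp v" for v x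
  proof (rule ccontr)
    assume "\<not> fst x < r"
    then have "v (fst x) = 0" using that(1) free by (auto simp: free_module_def)
    then show False using that(2) by (simp add: supp_def)
  qed
  have fin: "finite (supp v)" if v: "v \<in> M" for v
  proof (rule finite_subset)
    show "supp v \<subseteq> (\<Union>b<r. {b} \<times> Poly_Mapping.keys (v b))"
      using supp_bound[OF v] by (auto simp: supp_def)
  qed auto
  have ne: "supp v \<noteq> {}" if "v \<noteq> 0" for v
  proof -
    obtain b where "v b \<noteq> 0" using \<open>v \<noteq> 0\<close> by (auto simp: fun_eq_iff)
    then obtain t where "t \<in> Poly_Mapping.keys (v b)"
      by (auto simp: poly_mapping_eq_iff fun_eq_iff in_keys_iff)
    then have "(b, t) \<in> supp v" by (simp add: supp_def)
    then show ?thesis by blast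
  qed
  have le: "\<kappa> x \<le> \<mu> v" if "v \<in> M" "x \<in> supp v" for v x
    using that fin by (simp add: \<mu>_def)
  have attained: "\<exists>x\<in>supp v. \<kappa> x = \<mu> v" if "v \<in> M" "v \<noteq> 0" for v
  proof -
    have "\<mu> v \<in> \<kappa> ` supp v"
      unfolding \<mu>_def using fin[OF that(1)] ne[OF that(2)] by (intro Max_in) auto
    then show ?thesis by auto
  qed
  define P where "P f n v \<longleftrightarrow> v \<in> M - vec.span (f ` {..<n}) \<and>
      (\<forall>w\<in>M - vec.span (f ` {..<n}). \<mu> v \<le> \<mu> w)" for f :: "nat \<Rightarrow> nat \<Rightarrow> ('n, 'k) mpoly" and n v
  \<comment> \<open>The span to be avoided involves all previous choices, which calls for choice
    along the well-order rather than from one step to the next.\<close>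
  have "\<exists>f. \<forall>n. P f n (f n)"
  proof (rule dependent_wellorder_choice[where P = P])
    fix v and f g :: "nat \<Rightarrow> nat \<Rightarrow> ('n, 'k) mpoly" and n
    assume "\<And>k. k < n \<Longrightarrow> f k = g k"
    then have "f ` {..<n} = g ` {..<n}" by auto
    then show "P f n v = P g n v" by (simp only: P_def)
  next
    fix n f
    assume "\<And>k. k < n \<Longrightarrow> P f k (f k)"
    then have sub: "f ` {..<n} \<subseteq> M" by (auto simp: P_def)
    then have "vec.span (f ` {..<n}) \<noteq> M" by (intro not_fg) auto
    then have "M - vec.span (f ` {..<n}) \<noteq> {}"
      using vec.span_minimal[OF sub M] by auto
    then obtain v where "v \<in> M - vec.span (f ` {..<n})" by (meson ex_in_conv)
    then show "\<exists>v. P f n v"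
      unfolding P_def Ball_def
      by (rule ex_has_least_nat[where P = "\<lambda>v. v \<in> M - vec.span (f ` {..<n})" and m = \<mu>])
  qed
  then obtain f where P: "\<forall>n. P f n (f n)" ..
  have f: "f n \<in> M" "f n \<notin> vec.span (f ` {..<n})" for n using P by (simp_all add: P_def)
  have min: "\<mu> (f n) \<le> \<mu> w" if "w \<in> M - vec.span (f ` {..<n})" for n w
    using P that by (simp add: P_def)
  have "f n \<noteq> 0" for n using f(2)[of n] vec.span_zero by metis
  then have "\<exists>x. x \<in> supp (f n) \<and> \<kappa> x = \<mu> (f n)" for n using attained f(1) by blast
  then obtain x where x: "\<And>n. x n \<in> supp (f n)" "\<And>n. \<kappa> (x n) = \<mu> (f n)"
    by metis
  \<comment> \<open>Having both \<open>fst\<close> and \<open>r - fst\<close> non-decreasing forces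
    equal basis indices, since these are below r. Divisibility of monomials makes sense only for the
    same basis vector.\<close>
  define C :: "(nat \<times> ('n \<Rightarrow>\<^sub>0 nat) \<Rightarrow> nat) set"
    where "C = insert fst (insert (\<lambda>x. r - fst x) (range (\<lambda>i x. Poly_Mapping.lookup (snd x) i)))"
  have "finite C" by (simp add: C_def)
  then obtain g where g: "strict_mono g" "\<And>c. c \<in> C \<Longrightarrow> incseq (\<lambda>n. c (x (g n)))"
    using incseq_subseq_finite[of C x] by blast
  define i j where "i = g 0" and "j = g 1"
  have "i < j" using g(1) by (simp add: i_def j_def strict_mono_def)
  have dickson: "c (x i) \<le> c (x j)" if "c \<in> C" for c
    using g(2)[OF that] by (auto simp: incseq_def i_def j_def)
  have "fst (x i) \<le> fst (x j)" "r - fst (x i) \<le> r - fst (x j)"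
    using dickson by (auto simp: C_def)
  moreover have "fst (x i) < r" "fst (x j) < r" using supp_bound f(1) x(1) by blast+
  ultimately have fst_eq: "fst (x j) = fst (x i)" by linarith
  define b ti tj where "b = fst (x i)" and "ti = snd (x i)" and "tj = snd (x j)"
  have xi: "x i = (b, ti)" and xj: "x j = (b, tj)"
    by (simp_all add: b_def ti_def tj_def fst_eq prod_eq_iff)
  have "(\<lambda>x. Poly_Mapping.lookup (snd x) k) \<in> C" for k by (auto simp: C_def)
  then have "Poly_Mapping.lookup ti k \<le> Poly_Mapping.lookup tj k" for k
    using dickson[of "\<lambda>x. Poly_Mapping.lookup (snd x) k"] by (simp add: xi xj)
  then have s: "(tj - ti) + ti = tj" by (rule exponent_add_diff)
  \<comment> \<open>The quotient of the leading coefficients, chosen so that \<open>w\<close> has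
    coefficient 0 at the leading monomial of \<open>f j\<close>.\<close>
  define c where "c = Poly_Mapping.lookup (f j b) tj / Poly_Mapping.lookup (f i b) ti"
  define q where "q = monomial (tj - ti) c"
  define w where "w = f j - vscale q (f i)"
  have wM: "w \<in> M"
    unfolding w_def using M f(1) by (intro vec.subspace_diff vec.subspace_scale)
  have "vscale q (f i) \<in> vec.span (f ` {..<j})"
    using \<open>i < j\<close> by (intro vec.span_scale vec.span_base imageI) simp
  then have w: "w \<notin> vec.span (f ` {..<j})"
    using f(2)[of j] vec.span_add unfolding w_def by fastforce
  then have "w \<noteq> 0" using vec.span_zero by metis
  then obtain y where y: "y \<in> supp w" "\<kappa> y = \<mu> w" using attained wM by blast
  have ti: "Poly_Mapping.lookup (f i b) ti \<noteq> 0"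
    using x(1)[of i] by (simp add: xi supp_def in_keys_iff)
  have "Poly_Mapping.lookup (q * f i b) tj = c * Poly_Mapping.lookup (f i b) ti"
    using lookup_monomial_mult[of "tj - ti" c "f i b" ti] by (simp add: q_def s)
  then have "Poly_Mapping.lookup (w b) tj = 0"
    using ti by (simp add: w_def lookup_minus c_def)
  then have "y \<noteq> x j" using y(1) by (auto simp: supp_def in_keys_iff xj)
  have "\<kappa> y \<le> \<kappa> (x j)"
  proof (cases "y \<in> supp (f j)")
    case True
    then show ?thesis using le f(1) x(2) by simp
  next
    case False
    then have "snd y \<in> Poly_Mapping.keys (q * f i (fst y))"
      using y(1) by (auto simp: supp_def in_keys_iff w_def lookup_minus)
    then obtain u where u: "u \<in> Poly_Mapping.keys (f i (fst y))" "snd y = (tj - ti) + u"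
      using keys_monomial_mult[of "tj - ti" c] by (auto simp: q_def)
    \<comment> \<open>Multiplication by a monomial multiplies all weights by the same factor, so no
      monomial of the subtracted multiple outweighs its leading one, which is
      \<open>x j\<close>.\<close>
    have "\<kappa> (fst y, u) \<le> \<kappa> (x i)" using le[OF f(1), of "(fst y, u)" i] u(1) x(2) by (simp add: supp_def)
    then have "\<kappa> (fst y, (tj - ti) + u) \<le> \<kappa> (b, (tj - ti) + ti)"
      by (simp add: mult xi)
    then show ?thesis using u(2) by (metis s xj prod.collapse)
  qed
  \<comment> \<open>The monomial \<open>x j\<close> was cancelled and \<kappa> is injective, so the
    leading weight of \<open>w\<close> is strictly below that of \<open>f j\<close>. But
    \<open>w\<close> is outside the span too, contrary to the minimality of
    \<open>f j\<close>.\<close>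
  moreover have "\<kappa> y \<noteq> \<kappa> (x j)"
    using inj_onD[OF inj, of y "x j"] \<open>y \<noteq> x j\<close> supp_bound[OF wM y(1)] supp_bound[OF f(1) x(1), of j]
    by (auto simp: mem_Times_iff)
  moreover have "\<kappa> (x j) \<le> \<kappa> y" using min[of w j] wM w y(2) x(2) by simp
  ultimately show False by simp
qed

section \<open>Homogeneous generators and the stepwise construction of a resolution\<close>

lemma graded_submodule_generators:
  fixes M :: "(nat \<Rightarrow> ('n::finite, 'k::field) mpoly) set"
  assumes M: "graded_submodule r \<delta> M"
  obtains s w \<epsilon> where "\<forall>b<s. w b \<in> hvec r \<delta> (\<epsilon> b)" "M = lin_comb s w ` free_module s"
proof -
  have sub: "vec.subspace M" and free: "M \<subseteq> free_module r"
    and closed: "\<And>v j. v \<in> M \<Longrightarrow> hvproj \<delta> j v \<in> M"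
    using M by (auto simp: graded_submodule_def)
  obtain S where S: "finite S" "S \<subseteq> M" "vec.span S = M"
    using submodule_finitely_generated[OF sub free] .
  \<comment> \<open>All degrees occurring in the generators; a monomial X^t times the b-th basis
    vector has degree \<open>total_degree t + \<delta> b\<close>.\<close>
  define D where "D = (\<Union>v\<in>S. \<Union>b<r. (\<lambda>t. int (total_degree t) + \<delta> b) ` Poly_Mapping.keys (v b))"
  have D: "finite D" using S(1) by (simp add: D_def)
  \<comment> \<open>Basis elements are numbered by naturals, so the pairs of a generator and a
    degree are listed. A part may be 0; its degree is therefore read off the list and not off the
    vector.\<close>
  then obtain xs where xs: "set xs = S \<times> D" using finite_list S(1) by (metis finite_cartesian_product)
  define w where "w b = hvproj \<delta> (snd (xs ! b)) (fst (xs ! b))" for b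
  have mem: "xs ! b \<in> S \<times> D" if "b < length xs" for b using that xs nth_mem by blast
  have "v \<in> vec.span (w ` {..<length xs})" if v: "v \<in> S" for v
  proof -
    have "(\<Sum>j\<in>D. hvproj \<delta> j v b) = v b" for b
    proof (cases "b < r")
      case True
      have "(\<Sum>j\<in>D. hvproj \<delta> j v b) = (\<Sum>d\<in>(\<lambda>j. j - \<delta> b) ` D. hproj d (v b))"
        by (subst sum.reindex) (auto simp: inj_on_def hvproj_def)
      also have "\<dots> = v b"
      proof (rule sum_hproj)
        show "(int \<circ> total_degree) ` Poly_Mapping.keys (v b) \<subseteq> (\<lambda>j. j - \<delta> b) ` D"
        proof clarify
          fix t assume "t \<in> Poly_Mapping.keys (v b)"
          then have "int (total_degree t) + \<delta> b \<in> D" using v True by (auto simp: D_def)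
          then show "(int \<circ> total_degree) t \<in> (\<lambda>j. j - \<delta> b) ` D" by force
        qed
      qed (use D in simp)
      finally show ?thesis .
    next
      case False
      then have "v b = 0" using v S(2) free by (auto simp: free_module_def)
      then show ?thesis by (simp add: hvproj_def)
    qed
    then have "v = (\<Sum>j\<in>D. hvproj \<delta> j v)" by (simp add: fun_eq_iff sum_vec_apply)
    moreover have "hvproj \<delta> j v \<in> w ` {..<length xs}" if "j \<in> D" for j
    proof -
      have "(v, j) \<in> set xs" using v that xs by simp
      then obtain b where "b < length xs" "xs ! b = (v, j)" by (auto simp: in_set_conv_nth)
      then show ?thesis by (force simp: w_def)
    qed
    ultimately show ?thesis by (metis vec.span_sum vec.span_base)
  qed
  then have "M \<subseteq> vec.span (w ` {..<length xs})"
    unfolding S(3)[symmetric] by (intro vec.span_minimal) auto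
  moreover have "w ` {..<length xs} \<subseteq> M" using mem S(2) closed by (auto simp: w_def mem_Times_iff)
  then have "vec.span (w ` {..<length xs}) \<subseteq> M" by (rule vec.span_minimal) (rule sub)
  ultimately have image: "M = lin_comb (length xs) w ` free_module (length xs)"
    by (auto simp: range_lin_comb)
  have "\<forall>b<length xs. w b \<in> hvec r \<delta> (snd (xs ! b))"
    unfolding w_def using mem S(2) free by (fastforce intro: hvproj_in simp: mem_Times_iff)
  then show ?thesis using image by (rule that[where \<epsilon> = "\<lambda>b. snd (xs ! b)"])
qed

lemma homogeneous_entries:
  assumes "w \<in> hvec r \<delta> j"
  shows "w c \<in> homogeneous_component (j - \<delta> c)"
  using assms by (simp add: hvec_def)

text \<open>A kernel of a degree-0 map between free modules of finite rank is a graded submodule,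
  hence again covered by finitely many homogeneous generators. Iterating this from I yields the
  resolution.\<close>

lemma graded_free_resolution_exists:
  fixes I :: "('n::finite, 'k::field) mpoly set"
  assumes I: "homogeneous_ideal I"
  shows "\<exists>F. graded_free_resolution F I"
proof -
  let ?init = "(1, \<lambda>_. 0, \<lambda>_. 0, ideal_vecs I)"
  \<comment> \<open>A state holds the rank and degrees of a free module, the columns of the map
    leaving it, and the graded submodule that the next map must cover: I at the start, a kernel
    afterwards. The columns in \<open>?init\<close> are a placeholder.\<close>
  define P :: "nat \<Rightarrow> nat \<times> (nat \<Rightarrow> int) \<times> (nat \<Rightarrow> nat \<Rightarrow> ('n, 'k) mpoly) \<times> (nat \<Rightarrow> ('n, 'k) mpoly) set \<Rightarrow> bool"
    where "P n = (\<lambda>(r, \<delta>, w, M). graded_submodule r \<delta> M \<and> (n = 0 \<longrightarrow> (r, \<delta>, w, M) = ?init))" for n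
  define Q :: "nat \<Rightarrow> nat \<times> (nat \<Rightarrow> int) \<times> (nat \<Rightarrow> nat \<Rightarrow> ('n, 'k) mpoly) \<times> (nat \<Rightarrow> ('n, 'k) mpoly) set \<Rightarrow>
      nat \<times> (nat \<Rightarrow> int) \<times> (nat \<Rightarrow> nat \<Rightarrow> ('n, 'k) mpoly) \<times> (nat \<Rightarrow> ('n, 'k) mpoly) set \<Rightarrow> bool"
    where "Q n = (\<lambda>(r, \<delta>, _, M) (s, \<epsilon>, w, N). (\<forall>b<s. w b \<in> hvec r \<delta> (\<epsilon> b)) \<and>
      M = lin_comb s w ` free_module s \<and> N = {v \<in> free_module s. lin_comb s w v = 0})" for n
  have "\<exists>X. \<forall>n. P n (X n) \<and> Q n (X n) (X (Suc n))"
  proof (rule dependent_nat_choice)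
    show "\<exists>x. P 0 x"
      using graded_submodule_ideal_vecs[OF I] by (intro exI[of _ ?init]) (simp add: P_def)
  next
    fix x n
    assume "P n x"
    then obtain r \<delta> v M where x: "x = (r, \<delta>, v, M)" and M: "graded_submodule r \<delta> M"
      by (auto simp: P_def)
    obtain s w \<epsilon> where w: "\<forall>b<s. w b \<in> hvec r \<delta> (\<epsilon> b)"
      and gen: "M = lin_comb s w ` free_module s"
      using graded_submodule_generators[OF M] .
    have "graded_map s \<epsilon> r \<delta> (lin_comb s w)" by (rule graded_map_lin_comb) (simp add: w)
    from graded_submodule_vimage[OF this graded_submodule_0]
    have "graded_submodule s \<epsilon> {v \<in> free_module s. lin_comb s w v \<in> {0}}" .
    then show "\<exists>y. P (Suc n) y \<and> Q n x y"
      using w gen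
      by (intro exI[of _ "(s, \<epsilon>, w, {v \<in> free_module s. lin_comb s w v = 0})"])
        (auto simp: P_def Q_def x)
  qed
  then obtain X where PX: "\<And>n. P n (X n)" and QX: "\<And>n. Q n (X n) (X (Suc n))" by blast
  define r \<delta> w M where "r n = fst (X n)" and "\<delta> n = fst (snd (X n))"
    and "w n = fst (snd (snd (X n)))" and "M n = snd (snd (snd (X n)))" for n
  have X: "X n = (r n, \<delta> n, w n, M n)" for n by (simp add: r_def \<delta>_def w_def M_def)
  have X0: "r 0 = 1" "\<delta> 0 = (\<lambda>_. 0)" "M 0 = ideal_vecs I"
    using PX[of 0] by (simp_all add: P_def X)
  have w: "w (Suc n) b \<in> hvec (r n) (\<delta> n) (\<delta> (Suc n) b)" if "b < r (Suc n)" for n b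
    using QX[of n] that by (simp add: Q_def X)
  have M: "M n = lin_comb (r (Suc n)) (w (Suc n)) ` free_module (r (Suc n))"
    and M_Suc: "M (Suc n) = {v \<in> free_module (r (Suc n)). lin_comb (r (Suc n)) (w (Suc n)) v = 0}"
    for n
    using QX[of n] by (simp_all add: Q_def X)
  \<comment> \<open>The module at position 0 is R itself, so the augmentation is multiplication by
    1. \<open>dmat\<close> takes the row before the column, \<open>w\<close> the column before the
    row.\<close>
  define F where "F = \<lparr>rk = r, bdeg = \<delta>, dmat = (\<lambda>i c b. w i b c), aug = (\<lambda>_. 1)\<rparr>"
  have d: "differential (rk F) (dmat F) (Suc n) = lin_comb (r (Suc n)) (w (Suc n))" for n
  proof -
    have "(\<lambda>c. if c < r n then w (Suc n) b c else 0) = w (Suc n) b" if "b < r (Suc n)" for b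
      using w[OF that] by (auto simp: hvec_def free_module_def)
    then show ?thesis
      by (auto simp: F_def differential_Suc lin_comb_def intro!: sum.cong)
  qed
  have "graded_free_resolution F I"
    unfolding graded_free_resolution_def
  proof (intro conjI allI impI)
    fix b assume "b < rk F 0"
    show "aug F b \<in> homogeneous_component (bdeg F 0 b)"
      using homogeneous_component_one by (simp add: F_def X0)
  next
    fix i c b :: nat assume "1 \<le> i" "c < rk F (i - 1)" "b < rk F i"
    then obtain n where n: "i = Suc n" "b < r (Suc n)" by (cases i) (auto simp: F_def)
    show "dmat F i c b \<in> homogeneous_component (bdeg F i b - bdeg F (i - 1) c)"
      using homogeneous_entries[OF w[OF n(2)]] by (simp add: F_def n(1))
  next
    fix f :: "('n, 'k) mpoly"
    have "(\<lambda>b. if b = 0 then f else 0) \<in> free_module (rk F 0)"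
      by (simp add: F_def X0 free_module_def)
    moreover have "f - augmentation F (\<lambda>b. if b = 0 then f else 0) = 0"
      by (simp add: augmentation_def F_def X0)
    moreover have "0 \<in> I"
      using graded_submodule_ideal_vecs[OF I]
      by (auto simp: graded_submodule_def ideal_vecs_def dest: vec.subspace_0)
    ultimately show "\<exists>v\<in>free_module (rk F 0). f - augmentation F v \<in> I" by metis
  next
    have "{v \<in> free_module (rk F 0). augmentation F v \<in> I} = M 0"
      by (simp add: X0 ideal_vecs_def F_def augmentation_def)
    then show "{v \<in> free_module (rk F 0). augmentation F v \<in> I}
        = differential (rk F) (dmat F) 1 ` free_module (rk F 1)"
      using M[of 0] d[of 0] by (simp add: F_def)
  next
    fix i :: nat assume "1 \<le> i"
    then obtain n where n: "i = Suc n" by (cases i) auto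
    show "{v \<in> free_module (rk F i). differential (rk F) (dmat F) i v = 0}
        = differential (rk F) (dmat F) (i + 1) ` free_module (rk F (i + 1))"
      using M[of "Suc n"] M_Suc[of n] d[of n] d[of "Suc n"] by (simp add: n F_def)
  qed
  then show ?thesis by blast
qed

section \<open>Comparison of resolutions\<close>

text \<open>
  A resolution of \<open>R/I\<close> with the augmentation as differential \<open>d 0\<close>: position \<open>0\<close> is \<open>R\<close> itself, in
  which equality is replaced by congruence modulo \<open>I\<close>, and position \<open>i + 1\<close> is \<open>F\<^sub>i\<close>.
\<close>

definition relations :: "(nat \<Rightarrow> 'a::zero) set \<Rightarrow> nat \<Rightarrow> (nat \<Rightarrow> 'a) set" where
  "relations N i = (if i = 0 then N else {0})"

definition augmented_resolution ::
  "(nat \<Rightarrow> nat) \<Rightarrow> (nat \<Rightarrow> nat \<Rightarrow> int) \<Rightarrow>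
    (nat \<Rightarrow> (nat \<Rightarrow> ('n::finite, 'k::field) mpoly) \<Rightarrow> nat \<Rightarrow> ('n, 'k) mpoly) \<Rightarrow>
    (nat \<Rightarrow> ('n, 'k) mpoly) set \<Rightarrow> bool" where
  "augmented_resolution r \<delta> d N \<longleftrightarrow>
    graded_submodule (r 0) (\<delta> 0) N \<and>
    (\<forall>i. graded_map (r (Suc i)) (\<delta> (Suc i)) (r i) (\<delta> i) (d i)) \<and>
    (\<forall>w\<in>free_module (r 0). \<exists>v\<in>free_module (r 1). d 0 v - w \<in> N) \<and>
    (\<forall>i. {v \<in> free_module (r (Suc i)). d i v \<in> relations N i}
      = d (Suc i) ` free_module (r (Suc (Suc i))))"

lemma
  assumes "augmented_resolution r \<delta> d N"
  shows augmented_resolution_relations: "graded_submodule (r i) (\<delta> i) (relations N i)"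
    and augmented_resolution_map: "graded_map (r (Suc i)) (\<delta> (Suc i)) (r i) (\<delta> i) (d i)"
    and augmented_resolution_onto:
      "w \<in> free_module (r 0) \<Longrightarrow> \<exists>v\<in>free_module (r 1). d 0 v - w \<in> N"
    and augmented_resolution_exact: "v \<in> free_module (r (Suc i)) \<Longrightarrow> d i v \<in> relations N i \<Longrightarrow>
      \<exists>w\<in>free_module (r (Suc (Suc i))). d (Suc i) w = v"
    and augmented_resolution_complex:
      "w \<in> free_module (r (Suc (Suc i))) \<Longrightarrow> d i (d (Suc i) w) \<in> relations N i"
proof -
  have exact: "{v \<in> free_module (r (Suc i)). d i v \<in> relations N i}
      = d (Suc i) ` free_module (r (Suc (Suc i)))"
    using assms by (auto simp: augmented_resolution_def)
  show "graded_submodule (r i) (\<delta> i) (relations N i)"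
    using assms by (simp add: augmented_resolution_def relations_def graded_submodule_0)
  show "graded_map (r (Suc i)) (\<delta> (Suc i)) (r i) (\<delta> i) (d i)"
    using assms by (simp add: augmented_resolution_def)
  show "w \<in> free_module (r 0) \<Longrightarrow> \<exists>v\<in>free_module (r 1). d 0 v - w \<in> N"
    using assms by (simp add: augmented_resolution_def)
  show "v \<in> free_module (r (Suc i)) \<Longrightarrow> d i v \<in> relations N i \<Longrightarrow>
      \<exists>w\<in>free_module (r (Suc (Suc i))). d (Suc i) w = v"
    using exact unfolding set_eq_iff image_iff mem_Collect_eq by metis
  show "w \<in> free_module (r (Suc (Suc i))) \<Longrightarrow> d i (d (Suc i) w) \<in> relations N i"
    using exact by (auto simp: set_eq_iff image_iff)
qed

section \<open>The comparison theorem: lifting the identity of R/I to chain maps, and uniqueness up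
  to homotopy\<close>

definition chain_map ::
  "(nat \<Rightarrow> nat) \<Rightarrow> (nat \<Rightarrow> nat \<Rightarrow> int) \<Rightarrow>
    (nat \<Rightarrow> (nat \<Rightarrow> ('n::finite, 'k::field) mpoly) \<Rightarrow> nat \<Rightarrow> ('n, 'k) mpoly) \<Rightarrow>
    (nat \<Rightarrow> nat) \<Rightarrow> (nat \<Rightarrow> nat \<Rightarrow> int) \<Rightarrow>
    (nat \<Rightarrow> (nat \<Rightarrow> ('n, 'k) mpoly) \<Rightarrow> nat \<Rightarrow> ('n, 'k) mpoly) \<Rightarrow>
    (nat \<Rightarrow> ('n, 'k) mpoly) set \<Rightarrow>
    (nat \<Rightarrow> (nat \<Rightarrow> ('n, 'k) mpoly) \<Rightarrow> nat \<Rightarrow> ('n, 'k) mpoly) \<Rightarrow> bool" where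
  "chain_map r \<delta> d s \<epsilon> e N \<alpha> \<longleftrightarrow>
    \<alpha> 0 = (\<lambda>v. v) \<and>
    (\<forall>i. graded_map (r i) (\<delta> i) (s i) (\<epsilon> i) (\<alpha> i)) \<and>
    (\<forall>i. \<forall>v\<in>free_module (r (Suc i)). e i (\<alpha> (Suc i) v) - \<alpha> i (d i v) \<in> relations N i)"

lemma graded_submodule_diff_iff:
  assumes "graded_submodule r \<delta> M" "x - y \<in> M"
  shows "x \<in> M \<longleftrightarrow> y \<in> M"
  using assms vec.subspace_add[of M "x - y" y] vec.subspace_diff[of M x "x - y"]
  by (auto simp: graded_submodule_def)

lemma chain_map_Suc:
  assumes "chain_map r \<delta> d s \<epsilon> e N \<alpha>" "v \<in> free_module (r (Suc (Suc i)))"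
  shows "e (Suc i) (\<alpha> (Suc (Suc i)) v) = \<alpha> (Suc i) (d (Suc i) v)"
proof -
  have "e (Suc i) (\<alpha> (Suc (Suc i)) v) - \<alpha> (Suc i) (d (Suc i) v) \<in> relations N (Suc i)"
    using assms unfolding chain_map_def by blast
  then show ?thesis by (simp add: relations_def)
qed

lemma chain_map_exists:
  assumes X: "augmented_resolution r \<delta> d N" and Y: "augmented_resolution s \<epsilon> e N"
    and eq: "r 0 = s 0" "\<delta> 0 = \<epsilon> 0"
  obtains \<alpha> where "chain_map r \<delta> d s \<epsilon> e N \<alpha>"
proof -
  \<comment> \<open>The last conjunct is the invariant that keeps the recursion alive:
    \<open>a\<close> after \<open>d n\<close> lands, modulo relations, in the image of
    \<open>e n\<close>, as \<open>graded_lift\<close> requires for the next map.\<close>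
  define P where "P n a \<longleftrightarrow> graded_map (r n) (\<delta> n) (s n) (\<epsilon> n) a \<and> (n = 0 \<longrightarrow> a = (\<lambda>v. v)) \<and>
    (\<forall>v\<in>free_module (r (Suc n)). \<exists>w\<in>free_module (s (Suc n)). e n w - a (d n v) \<in> relations N n)"
    for n a
  define Q where "Q n a a' \<longleftrightarrow>
    (\<forall>v\<in>free_module (r (Suc n)). e n (a' v) - a (d n v) \<in> relations N n)" for n a a'
  note dX = augmented_resolution_map[OF X] and dY = augmented_resolution_map[OF Y]
    and NY = augmented_resolution_relations[OF Y]
  have "\<exists>\<alpha>. \<forall>n. P n (\<alpha> n) \<and> Q n (\<alpha> n) (\<alpha> (Suc n))"
  proof (rule dependent_nat_choice)
    have "\<exists>w\<in>free_module (s (Suc 0)). e 0 w - d 0 v \<in> N" if "v \<in> free_module (r (Suc 0))" for v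
      using augmented_resolution_onto[OF Y] graded_map_free[OF dX that] eq by simp
    then show "\<exists>a. P 0 a"
      using eq by (intro exI[of _ "\<lambda>v. v"]) (simp add: P_def graded_map_id relations_def)
  next
    fix a n
    assume "P n a"
    then have a: "graded_map (r n) (\<delta> n) (s n) (\<epsilon> n) a" "n = 0 \<Longrightarrow> a = (\<lambda>v. v)"
      and ex: "\<And>v. v \<in> free_module (r (Suc n)) \<Longrightarrow>
        \<exists>w\<in>free_module (s (Suc n)). e n w - a (d n v) \<in> relations N n"
      by (auto simp: P_def)
    obtain g where g: "graded_map (r (Suc n)) (\<delta> (Suc n)) (s (Suc n)) (\<epsilon> (Suc n)) g"
      and eg: "\<And>v. v \<in> free_module (r (Suc n)) \<Longrightarrow> e n (g v) - a (d n v) \<in> relations N n"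
      by (rule graded_lift[OF dY graded_map_compose[OF dX a(1)] NY])
        (auto intro: ex unit_vec_in_free_module)
    have "\<exists>w\<in>free_module (s (Suc (Suc n))). e (Suc n) w - g (d (Suc n) v) \<in> relations N (Suc n)"
      if v: "v \<in> free_module (r (Suc (Suc n)))" for v
    proof -
      let ?u = "d (Suc n) v"
      have u: "?u \<in> free_module (r (Suc n))" by (rule graded_map_free[OF dX v])
      \<comment> \<open>For n = 0 the element \<open>d n ?u\<close> is only known to lie in N, which
        is preserved because \<open>a\<close> is the identity; for larger n it is 0.\<close>
      have "a (d n ?u) \<in> relations N n"
        using augmented_resolution_complex[OF X v] a(2) graded_map_zero[OF a(1)]
        by (cases "n = 0") (auto simp: relations_def)
      then have "e n (g ?u) \<in> relations N n"
        using graded_submodule_diff_iff[OF NY eg[OF u]] by simp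
      then obtain w where "w \<in> free_module (s (Suc (Suc n)))" "e (Suc n) w = g ?u"
        using augmented_resolution_exact[OF Y graded_map_free[OF g u]] by blast
      then show ?thesis by (auto simp: relations_def)
    qed
    then show "\<exists>a'. P (Suc n) a' \<and> Q n a a'" using g eg by (auto simp: P_def Q_def)
  qed
  then obtain \<alpha> where "\<And>n. P n (\<alpha> n)" "\<And>n. Q n (\<alpha> n) (\<alpha> (Suc n))" by blast
  then have "chain_map r \<delta> d s \<epsilon> e N \<alpha>" by (auto simp: chain_map_def P_def Q_def)
  then show ?thesis by (rule that)
qed

lemma chain_map_compose:
  assumes Z: "augmented_resolution t \<zeta> k N"
    and \<alpha>: "chain_map r \<delta> d s \<epsilon> e N \<alpha>" and \<beta>: "chain_map s \<epsilon> e t \<zeta> k N \<beta>"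
  shows "chain_map r \<delta> d t \<zeta> k N (\<lambda>i v. \<beta> i (\<alpha> i v))"
proof -
  have a: "graded_map (r i) (\<delta> i) (s i) (\<epsilon> i) (\<alpha> i)"
    and b: "graded_map (s i) (\<epsilon> i) (t i) (\<zeta> i) (\<beta> i)" for i
    using \<alpha> \<beta> by (auto simp: chain_map_def)
  have "k i (\<beta> (Suc i) (\<alpha> (Suc i) v)) - \<beta> i (\<alpha> i (d i v)) \<in> relations N i"
    if v: "v \<in> free_module (r (Suc i))" for i v
  proof -
    have 1: "k i (\<beta> (Suc i) (\<alpha> (Suc i) v)) - \<beta> i (e i (\<alpha> (Suc i) v)) \<in> relations N i"
      using \<beta> graded_map_free[OF a v] by (simp add: chain_map_def)
    have "e i (\<alpha> (Suc i) v) - \<alpha> i (d i v) \<in> relations N i"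
      using \<alpha> v by (simp add: chain_map_def)
    then have 2: "\<beta> i (e i (\<alpha> (Suc i) v) - \<alpha> i (d i v)) \<in> relations N i"
      using \<beta> graded_map_zero[OF b] by (cases "i = 0") (auto simp: chain_map_def relations_def)
    show ?thesis
      using vec.subspace_add[OF _ 1 2] augmented_resolution_relations[OF Z, of i]
      by (simp add: graded_submodule_def graded_map_diff[OF b])
  qed
  then show ?thesis
    using \<alpha> \<beta> graded_map_compose[OF a b] by (simp add: chain_map_def)
qed

text \<open>Since \<gamma> lifts the identity of R/I, the difference of \<gamma> and the identity,
  corrected by the homotopy one position below, takes values in cycles. Exactness provides
  preimages, and \<open>graded_lift\<close> makes them into a degree-0 map.\<close>

lemma homotopy_to_identity:
  assumes X: "augmented_resolution r \<delta> d N" and \<gamma>: "chain_map r \<delta> d r \<delta> d N \<gamma>"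
  shows "\<exists>h. h 0 = (\<lambda>v. 0) \<and>
    (\<forall>i. graded_map (r i) (\<delta> i) (r (Suc i)) (\<delta> (Suc i)) (h i)) \<and>
    (\<forall>i. \<forall>v\<in>free_module (r (Suc i)).
      d (Suc i) (h (Suc i) v) = \<gamma> (Suc i) v - v - h i (d i v))"
proof -
  define P where "P n h \<longleftrightarrow> graded_map (r n) (\<delta> n) (r (Suc n)) (\<delta> (Suc n)) h \<and>
    (n = 0 \<longrightarrow> h = (\<lambda>v. 0)) \<and>
    (\<forall>v\<in>free_module (r (Suc n)). \<exists>w\<in>free_module (r (Suc (Suc n))).
      d (Suc n) w = \<gamma> (Suc n) v - v - h (d n v))" for n h
  define Q where "Q n h h' \<longleftrightarrow> (\<forall>v\<in>free_module (r (Suc n)).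
    d (Suc n) (h' v) = \<gamma> (Suc n) v - v - h (d n v))" for n h h'
  note d = augmented_resolution_map[OF X] and exact = augmented_resolution_exact[OF X]
  have \<gamma>0: "\<gamma> 0 = (\<lambda>v. v)" and g: "graded_map (r i) (\<delta> i) (r i) (\<delta> i) (\<gamma> i)"
    and \<gamma>d: "v \<in> free_module (r (Suc i)) \<Longrightarrow> d i (\<gamma> (Suc i) v) - \<gamma> i (d i v) \<in> relations N i"
    for i v
    using \<gamma> by (auto simp: chain_map_def)
  have "\<exists>h. \<forall>n. P n (h n) \<and> Q n (h n) (h (Suc n))"
  proof (rule dependent_nat_choice)
    have "\<exists>w\<in>free_module (r (Suc (Suc 0))). d (Suc 0) w = \<gamma> (Suc 0) v - v"
      if v: "v \<in> free_module (r (Suc 0))" for v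
    proof (rule exact)
      show "\<gamma> (Suc 0) v - v \<in> free_module (r (Suc 0))"
        by (intro vec.subspace_diff subspace_free_module graded_map_free[OF g] v)
      show "d 0 (\<gamma> (Suc 0) v - v) \<in> relations N 0"
        using \<gamma>d[OF v] by (simp add: \<gamma>0 graded_map_diff[OF d])
    qed
    then show "\<exists>h. P 0 h"
      by (intro exI[of _ "\<lambda>v. 0"]) (simp add: P_def graded_map_0)
  next
    fix h n
    assume "P n h"
    then have h: "graded_map (r n) (\<delta> n) (r (Suc n)) (\<delta> (Suc n)) h" "n = 0 \<Longrightarrow> h = (\<lambda>v. 0)"
      and ex: "\<And>v. v \<in> free_module (r (Suc n)) \<Longrightarrow> \<exists>w\<in>free_module (r (Suc (Suc n))).
        d (Suc n) w = \<gamma> (Suc n) v - v - h (d n v)"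
      by (auto simp: P_def)
    have f: "graded_map (r (Suc n)) (\<delta> (Suc n)) (r (Suc n)) (\<delta> (Suc n))
        (\<lambda>v. \<gamma> (Suc n) v - v - h (d n v))"
      by (intro graded_map_minus g graded_map_id graded_map_compose[OF d h(1)])
    obtain h' where h': "graded_map (r (Suc n)) (\<delta> (Suc n)) (r (Suc (Suc n))) (\<delta> (Suc (Suc n))) h'"
      and "\<And>v. v \<in> free_module (r (Suc n)) \<Longrightarrow>
        d (Suc n) (h' v) - (\<gamma> (Suc n) v - v - h (d n v)) \<in> {0}"
      by (rule graded_lift[OF d f graded_submodule_0])
        (auto dest: ex[OF unit_vec_in_free_module])
    then have dh': "d (Suc n) (h' v) = \<gamma> (Suc n) v - v - h (d n v)"
      if "v \<in> free_module (r (Suc n))" for v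
      using that by force
    have "\<exists>w\<in>free_module (r (Suc (Suc (Suc n)))).
        d (Suc (Suc n)) w = \<gamma> (Suc (Suc n)) v - v - h' (d (Suc n) v)"
      if v: "v \<in> free_module (r (Suc (Suc n)))" for v
    proof (rule exact)
      have u: "d (Suc n) v \<in> free_module (r (Suc n))" by (rule graded_map_free[OF d v])
      show "\<gamma> (Suc (Suc n)) v - v - h' (d (Suc n) v) \<in> free_module (r (Suc (Suc n)))"
        by (intro vec.subspace_diff subspace_free_module graded_map_free[OF g]
            graded_map_free[OF h'] u v)
      \<comment> \<open>At n = 0 two successive differentials give an element of N, not necessarily
        0; there the term vanishes because \<open>h 0\<close> is zero.\<close>
      have "h (d n (d (Suc n) v)) = 0"
        using augmented_resolution_complex[OF X v] h(2) graded_map_zero[OF h(1)]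
        by (cases "n = 0") (auto simp: relations_def)
      moreover have "d (Suc n) (\<gamma> (Suc (Suc n)) v) = \<gamma> (Suc n) (d (Suc n) v)"
        using \<gamma>d[OF v] by (simp add: relations_def)
      ultimately show "d (Suc n) (\<gamma> (Suc (Suc n)) v - v - h' (d (Suc n) v)) \<in> relations N (Suc n)"
        by (simp add: relations_def graded_map_diff[OF d] dh'[OF u])
    qed
    then show "\<exists>h'. P (Suc n) h' \<and> Q n h h'" using h' dh' by (auto simp: P_def Q_def)
  qed
  then obtain h where P: "\<And>n. P n (h n)" and Q: "\<And>n. Q n (h n) (h (Suc n))" by blast
  show ?thesis
    using P[of 0] P Q unfolding P_def Q_def by (intro exI[of _ h]) auto
qed

subsection \<open>Tensoring with the residue field\<close>

text \<open>The map K \<otimes> f in coordinates: lift to constant polynomials, apply f, reduce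
  modulo the variables.\<close>

definition residue_map ::
  "((nat \<Rightarrow> ('n::finite, 'k::field) mpoly) \<Rightarrow> nat \<Rightarrow> ('n, 'k) mpoly) \<Rightarrow> (nat \<Rightarrow> 'k) \<Rightarrow> nat \<Rightarrow> 'k" where
  "residue_map f u = (\<lambda>c. const_coeff (f (\<lambda>b. Const (u b)) c))"

lemma Const_zero [simp]: "Const 0 = 0"
  and Const_add: "Const (a + b) = Const a + Const b"
  and Const_mult: "Const (a * b) = Const a * Const b"
  by (simp_all add: Const_def single_add mult_single)

lemma Const_homogeneous: "Const a \<in> homogeneous_component 0"
  by (simp add: homogeneous_component_def Const_def total_degree_def)

lemma const_coeff_homogeneous:
  "f \<in> homogeneous_component d \<Longrightarrow> const_coeff f \<noteq> 0 \<Longrightarrow> d = 0"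
  using total_degree_add[of 0 0]
  by (auto simp: homogeneous_component_def const_coeff_def in_keys_iff)

lemma vec_linear_residue_map:
  assumes "vec_linear f"
  shows "vec_linear (residue_map f)"
proof -
  interpret f: module_hom vscale vscale f by fact
  show ?thesis
  proof (rule vec_linearI)
    fix x y :: "nat \<Rightarrow> 'b" and a
    show "residue_map f (x + y) = residue_map f x + residue_map f y"
      using f.add[of "\<lambda>b. Const (x b)" "\<lambda>b. Const (y b)"]
      by (simp add: residue_map_def plus_fun_def Const_add const_coeff_add)
    show "residue_map f (vscale a x) = vscale a (residue_map f x)"
      using f.scale[of "Const a" "\<lambda>b. Const (x b)"]
      by (simp add: residue_map_def vscale_def Const_mult const_coeff_mult)
  qed
qed

lemma Const_in_free_module: "u \<in> free_module r \<Longrightarrow> (\<lambda>b. Const (u b)) \<in> free_module r"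
  by (simp add: free_module_def)

text \<open>Any lift v may replace the constant one: f acts on \<open>free_module r\<close> through
  a matrix, and \<open>const_coeff\<close> is a ring homomorphism. Compatibility with composition
  rests on this.\<close>

lemma residue_map_const_coeff:
  assumes f: "vec_linear f" and v: "v \<in> free_module r"
  shows "residue_map f (\<lambda>b. const_coeff (v b)) = (\<lambda>c. const_coeff (f v c))"
proof -
  have "(\<lambda>b. Const (const_coeff (v b))) \<in> free_module r" using v by (simp add: free_module_def)
  from vec_linear_expansion[OF f this] vec_linear_expansion[OF f v] show ?thesis
    by (simp add: residue_map_def sum_vec_apply const_coeff_sum const_coeff_mult)
qed

lemma residue_map_compose:
  assumes f: "graded_map r \<delta> s \<epsilon> f" and g: "vec_linear g" and u: "u \<in> free_module r"
  shows "residue_map (\<lambda>v. g (f v)) u = residue_map g (residue_map f u)"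
  using residue_map_const_coeff[OF g graded_map_free[OF f Const_in_free_module[OF u]]]
  by (simp add: residue_map_def)

definition residue_piece :: "nat \<Rightarrow> (nat \<Rightarrow> int) \<Rightarrow> int \<Rightarrow> (nat \<Rightarrow> 'k::zero) set" where
  "residue_piece r \<delta> j = {u \<in> free_module r. \<forall>b. u b \<noteq> 0 \<longrightarrow> \<delta> b = j}"

text \<open>A homogeneous polynomial with nonzero constant coefficient has degree 0, so after
  reduction only basis elements of equal degree remain linked.\<close>

lemma residue_map_piece:
  assumes f: "graded_map r \<delta> s \<epsilon> f" and u: "u \<in> residue_piece r \<delta> j"
  shows "residue_map f u \<in> residue_piece s \<epsilon> j"
proof -
  have "Const (u b) \<in> homogeneous_component (j - \<delta> b)" for b
    using u Const_homogeneous by (cases "u b = 0") (auto simp: residue_piece_def)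
  then have "(\<lambda>b. Const (u b)) \<in> hvec r \<delta> j"
    using u by (auto simp: residue_piece_def hvec_def Const_in_free_module)
  then have "f (\<lambda>b. Const (u b)) \<in> hvec s \<epsilon> j" by (rule graded_map_hvec[OF f])
  then show ?thesis
    by (fastforce simp: residue_map_def residue_piece_def hvec_def free_module_def
        dest: const_coeff_homogeneous[rotated])
qed

lemma subspace_residue_piece: "vec.subspace (residue_piece r \<delta> j :: (nat \<Rightarrow> 'k::field) set)"
  by (auto simp: vec.subspace_def residue_piece_def free_module_def) (metis add.right_neutral)

lemma residue_map_diff:
  assumes "\<And>v. v \<in> free_module r \<Longrightarrow> f v = g v - k v" "u \<in> free_module r"
  shows "residue_map f u = residue_map g u - residue_map k u"
  using assms(1)[OF Const_in_free_module[OF assms(2)]]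
  by (simp add: residue_map_def fun_eq_iff const_coeff_diff)

lemma residue_map_id: "residue_map (\<lambda>v. v) u = u"
  by (simp add: residue_map_def)

lemma residue_map_0: "residue_map (\<lambda>v. 0) u = 0"
  by (simp add: residue_map_def fun_eq_iff)

lemma residue_map_cong:
  assumes "\<And>v. v \<in> free_module r \<Longrightarrow> f v = g v" "u \<in> free_module r"
  shows "residue_map f u = residue_map g u"
  using assms(1)[OF Const_in_free_module[OF assms(2)]] by (simp add: residue_map_def)

subsection \<open>Dimensions of homology\<close>

text \<open>The hypothesis \<open>inj\<close> expresses injectivity of Z/B -> Z'/B'. Extend a basis
  S of B to a basis T of Z: the images of T - S remain independent together with a basis of
  B'.\<close>

lemma (in vector_space_pair) dim_quotient_le:
  assumes f: "Vector_Spaces.linear s1 s2 f"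
    and B: "B \<subseteq> Z" and Z: "vs1.subspace Z" "Z \<subseteq> vs1.span X" "finite X"
    and B': "vs2.subspace B'" "B' \<subseteq> Z'" and Z': "Z' \<subseteq> vs2.span X'" "finite X'"
    and maps: "f ` Z \<subseteq> Z'" and inj: "\<And>z. z \<in> Z \<Longrightarrow> f z \<in> B' \<Longrightarrow> z \<in> B"
  shows "vs1.dim Z - vs1.dim B \<le> vs2.dim Z' - vs2.dim B'"
proof -
  interpret f: Vector_Spaces.linear s1 s2 f by fact
  obtain S where S: "S \<subseteq> B" "vs1.independent S" "B \<subseteq> vs1.span S" "card S = vs1.dim B"
    using vs1.basis_exists .
  have "S \<subseteq> Z" using S(1) B by (rule subset_trans)
  then obtain T where T: "S \<subseteq> T" "T \<subseteq> Z" "vs1.independent T" "Z \<subseteq> vs1.span T"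
    by (rule vs1.maximal_independent_subset_extend[OF _ S(2)])
  obtain S' where S': "S' \<subseteq> B'" "vs2.independent S'" "B' \<subseteq> vs2.span S'" "card S' = vs2.dim B'"
    using vs2.basis_exists .
  have finT: "finite T"
    using vs1.independent_span_bound[OF Z(3) T(3)] T(2) Z(2) by blast
  have finS': "finite S'"
    using vs2.independent_span_bound[OF Z'(2) S'(2)] S'(1) B'(2) Z'(1) by blast
  \<comment> \<open>Images are added one at a time. The cardinality is carried along because f might
    identify basis vectors.\<close>
  have "C \<subseteq> T - S \<longrightarrow> vs2.independent (f ` C \<union> S') \<and> card (f ` C \<union> S') = card C + card S'"
    if "finite C" for C
    using that
  proof (induction C)
    case empty
    show ?case using S'(2) by simp
  next
    case (insert x C)
    show ?case
    proof
      assume sub: "insert x C \<subseteq> T - S"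
      \<comment> \<open>Otherwise f agrees modulo B' on x and on some y in the span of C, so x - y
        lies in B, and x depends on other elements of T.\<close>
      have new: "f x \<notin> vs2.span (f ` C \<union> S')"
      proof
        assume "f x \<in> vs2.span (f ` C \<union> S')"
        then obtain a b where a: "a \<in> vs2.span (f ` C)" and b: "b \<in> vs2.span S'" and "f x = a + b"
          unfolding vs2.span_Un by blast
        moreover obtain y where y: "y \<in> vs1.span C" and "a = f y"
          using a unfolding f.span_image by (rule imageE)
        ultimately have eq: "f x = f y + b" by simp
        have CZ: "C \<subseteq> Z" and xZ: "x \<in> Z" using sub T(2) by auto
        have "y \<in> Z" using vs1.span_minimal[OF CZ Z(1)] y by blast
        then have "x - y \<in> Z" by (rule vs1.subspace_diff[OF Z(1) xZ])
        moreover have "f (x - y) \<in> B'"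
          using subsetD[OF vs2.span_minimal[OF S'(1) B'(1)] b] eq by (simp add: f.diff)
        ultimately have "x - y \<in> B" by (rule inj)
        then have "x - y \<in> vs1.span S" using S(3) by (rule subsetD[rotated])
        then have "y + (x - y) \<in> vs1.span (C \<union> S)"
          by (rule vs1.span_add[OF subsetD[OF vs1.span_mono[OF Un_upper1] y]
                subsetD[OF vs1.span_mono[OF Un_upper2]]])
        moreover have "insert x (C \<union> S) \<subseteq> T" using sub T(1) by auto
        then have "vs1.independent (insert x (C \<union> S))" by (rule vs1.independent_mono[OF T(3)])
        moreover have "x \<notin> C \<union> S" using insert.hyps sub by auto
        ultimately show False by (simp add: vs1.independent_insert)
      qed
      have "f x \<notin> f ` C \<union> S'" using new by (rule contrapos_nn) (rule vs2.span_base)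
      moreover have "vs2.independent (f ` C \<union> S')" "card (f ` C \<union> S') = card C + card S'"
        using insert.IH sub by blast+
      ultimately show "vs2.independent (f ` insert x C \<union> S') \<and>
          card (f ` insert x C \<union> S') = card (insert x C) + card S'"
        unfolding image_insert Un_insert_left using insert.hyps finS'
        by (intro conjI vs2.independent_insertI[OF new]) simp_all
    qed
  qed
  from this[of "T - S"] have ind: "vs2.independent (f ` (T - S) \<union> S')"
    and card: "card (f ` (T - S) \<union> S') = card (T - S) + card S'"
    using finT by simp_all
  have "f ` (T - S) \<union> S' \<subseteq> Z'" using maps T(2) S'(1) B'(2) by blast
  then obtain U where U: "f ` (T - S) \<union> S' \<subseteq> U" "U \<subseteq> Z'" "vs2.independent U" "Z' \<subseteq> vs2.span U"
    by (rule vs2.maximal_independent_subset_extend[OF _ ind])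
  have "finite U"
    using vs2.independent_span_bound[OF Z'(2) U(3)] U(2) Z'(1) by blast
  then have "card (T - S) + card S' \<le> vs2.dim Z'"
    using card_mono[OF _ U(1)] card vs2.basis_card_eq_dim[OF U(2,4,3)] by simp
  moreover have "card (T - S) = vs1.dim Z - vs1.dim B"
    using vs1.basis_card_eq_dim[OF T(2,4,3)] S(4) T(1) finT
    by (simp add: card_Diff_subset finite_subset)
  ultimately show ?thesis using S'(4) by simp
qed

lemma vector_space_vscale: "vector_space (vscale :: 'k::field \<Rightarrow> _)"
  by unfold_locales (simp_all add: fun_eq_iff algebra_simps)

lemma free_module_subset_span: "free_module r \<subseteq> vec.span (unit_vec ` {..<r})"
proof
  fix v :: "nat \<Rightarrow> 'a" assume "v \<in> free_module r"
  moreover have "(\<Sum>b<r. vscale (v b) (unit_vec b)) \<in> vec.span (unit_vec ` {..<r})"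
    by (intro vec.span_sum vec.span_scale vec.span_base) auto
  ultimately show "v \<in> vec.span (unit_vec ` {..<r})"
    using free_module_expansion by metis
qed

subsection \<open>Independence of the resolution\<close>

definition aug_rank :: "('n::finite, 'k::field) mpoly graded_complex \<Rightarrow> nat \<Rightarrow> nat" where
  "aug_rank F i = (case i of 0 \<Rightarrow> 1 | Suc k \<Rightarrow> rk F k)"

definition aug_deg :: "('n::finite, 'k::field) mpoly graded_complex \<Rightarrow> nat \<Rightarrow> nat \<Rightarrow> int" where
  "aug_deg F i = (case i of 0 \<Rightarrow> (\<lambda>_. 0) | Suc k \<Rightarrow> bdeg F k)"

definition aug_differential ::
  "('n::finite, 'k::field) mpoly graded_complex \<Rightarrow> nat \<Rightarrow> (nat \<Rightarrow> ('n, 'k) mpoly) \<Rightarrow> nat \<Rightarrow> ('n, 'k) mpoly"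
  where "aug_differential F i = (case i of
      0 \<Rightarrow> lin_comb (rk F 0) (\<lambda>b c. if c = 0 then aug F b else 0)
    | Suc k \<Rightarrow> differential (rk F) (dmat F) (Suc k))"

lemma aug_simps [simp]:
  "aug_rank F 0 = 1" "aug_rank F (Suc k) = rk F k"
  "aug_deg F 0 = (\<lambda>_. 0)" "aug_deg F (Suc k) = bdeg F k"
  "aug_differential F (Suc k) = differential (rk F) (dmat F) (Suc k)"
  by (simp_all add: aug_rank_def aug_deg_def aug_differential_def)

lemma aug_differential_0_apply:
  "aug_differential F 0 v = (\<lambda>c. if c = 0 then augmentation F v else 0)"
  by (auto simp: aug_differential_def lin_comb_def fun_eq_iff sum_vec_apply augmentation_def mult.commute)

lemma augmented_resolution:
  assumes F: "graded_free_resolution F I" and I: "homogeneous_ideal I"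
  shows "augmented_resolution (aug_rank F) (aug_deg F) (aug_differential F) (ideal_vecs I)"
  unfolding augmented_resolution_def
proof (intro conjI allI ballI)
  show "graded_submodule (aug_rank F 0) (aug_deg F 0) (ideal_vecs I)"
    using graded_submodule_ideal_vecs[OF I] by simp
next
  fix i
  show "graded_map (aug_rank F (Suc i)) (aug_deg F (Suc i)) (aug_rank F i) (aug_deg F i)
      (aug_differential F i)"
  proof (cases i)
    case 0
    then show ?thesis
      using F
      by (auto intro!: graded_map_lin_comb
          simp: aug_differential_def graded_free_resolution_def hvec_def free_module_def)
  next
    case (Suc k)
    have "\<forall>i\<ge>1. \<forall>c<rk F (i - 1). \<forall>b<rk F i.
        dmat F i c b \<in> homogeneous_component (bdeg F i b - bdeg F (i - 1) c)"
      using F by (simp add: graded_free_resolution_def)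
    from this[rule_format, of "Suc k"] Suc show ?thesis
      by (auto intro!: graded_map_lin_comb simp: differential_Suc hvec_def free_module_def)
  qed
next
  fix w :: "nat \<Rightarrow> ('a, 'b) mpoly"
  assume w: "w \<in> free_module (aug_rank F 0)"
  have "\<forall>f. \<exists>v\<in>free_module (rk F 0). f - augmentation F v \<in> I"
    using F by (simp add: graded_free_resolution_def)
  then obtain v where v: "v \<in> free_module (rk F 0)" "w 0 - augmentation F v \<in> I" by blast
  have "aug_differential F 0 v - w = - (\<lambda>c. if c = 0 then w 0 - augmentation F v else 0)"
    using w by (auto simp: aug_differential_0_apply fun_eq_iff free_module_def)
  moreover have "(\<lambda>c. if c = 0 then w 0 - augmentation F v else 0) \<in> ideal_vecs I"
    using v(2) by (simp add: ideal_vecs_def free_module_def)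
  ultimately have "aug_differential F 0 v - w \<in> ideal_vecs I"
    using graded_submodule_ideal_vecs[OF I] vec.subspace_neg
    by (metis graded_submodule_def)
  then show "\<exists>v\<in>free_module (aug_rank F 1). aug_differential F 0 v - w \<in> ideal_vecs I"
    using v(1) by auto
next
  fix i
  show "{v \<in> free_module (aug_rank F (Suc i)). aug_differential F i v \<in> relations (ideal_vecs I) i}
      = aug_differential F (Suc i) ` free_module (aug_rank F (Suc (Suc i)))"
  proof (cases i)
    case 0
    then show ?thesis
      using F
      by (simp add: relations_def aug_differential_0_apply ideal_vecs_def free_module_def
          graded_free_resolution_def)
  next
    case (Suc k)
    then show ?thesis using F by (simp add: relations_def graded_free_resolution_def)
  qed
qed

lemma tensor_differential_eq:
  "u \<in> free_module (rk F (Suc i)) \<Longrightarrow>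
    tensor_differential F (Suc i) u = residue_map (aug_differential F (Suc i)) u"
  by (auto simp: tensor_differential_def residue_map_def differential_def fun_eq_iff
      const_coeff_sum const_coeff_mult intro!: sum.cong)

lemma tensor_piece_eq: "tensor_piece F i j = residue_piece (rk F i) (bdeg F i) j"
  by (simp add: tensor_piece_def residue_piece_def)

lemma tensor_differential_0: "tensor_differential F 0 u = 0"
  by (simp add: tensor_differential_def differential_def fun_eq_iff)

text \<open>\<open>aug_differential F i\<close> is the map leaving position i of F. For i = 0 it is
  the augmentation, which the complex computing Tor omits; hence the guard.\<close>

lemma tor_cycles_iff:
  "u \<in> tor_cycles F i j \<longleftrightarrow> u \<in> residue_piece (rk F i) (bdeg F i) j \<and>
    (i \<noteq> 0 \<longrightarrow> residue_map (aug_differential F i) u = 0)"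
proof (cases i)
  case (Suc k)
  then show ?thesis
    using tensor_differential_eq[of u F k]
    by (auto simp: tor_cycles_def tensor_piece_eq residue_piece_def)
qed (simp add: tor_cycles_def tensor_piece_eq tensor_differential_0)

lemma tor_boundaries_eq:
  "tor_boundaries F i j
    = residue_map (aug_differential F (Suc i)) ` residue_piece (rk F (Suc i)) (bdeg F (Suc i)) j"
  unfolding tor_boundaries_def tensor_piece_eq
  by (rule image_cong) (auto simp: tensor_differential_eq residue_piece_def simp del: aug_simps)

lemma tor_dim_eq:
  "tor_dim F i j
    = vector_space.dim vscale (tor_cycles F i j) - vector_space.dim vscale (tor_boundaries F i j)"
  by (simp only: tor_dim_def vscale_def[abs_def])

text \<open>A chain map F -> G followed by one back is homotopic to the identity, so the first of
  them is injective on the homology of K \<otimes> F.\<close>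

lemma tor_dim_le:
  assumes F: "graded_free_resolution F I" and G: "graded_free_resolution G I"
    and I: "homogeneous_ideal I"
  shows "tor_dim F i j \<le> tor_dim G i j"
proof -
  let ?r = "aug_rank F" and ?\<delta> = "aug_deg F" and ?d = "aug_differential F"
    and ?s = "aug_rank G" and ?\<epsilon> = "aug_deg G" and ?e = "aug_differential G"
  let ?N = "ideal_vecs I"
  note X = augmented_resolution[OF F I] and Y = augmented_resolution[OF G I]
  note d = augmented_resolution_map[OF X] and e = augmented_resolution_map[OF Y]
  obtain \<alpha> where \<alpha>: "chain_map ?r ?\<delta> ?d ?s ?\<epsilon> ?e ?N \<alpha>"
    by (rule chain_map_exists[OF X Y]) simp_all
  obtain \<beta> where \<beta>: "chain_map ?s ?\<epsilon> ?e ?r ?\<delta> ?d ?N \<beta>"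
    by (rule chain_map_exists[OF Y X]) simp_all
  obtain h where h0: "h 0 = (\<lambda>v. 0)"
    and h_dh: "\<forall>i. graded_map (?r i) (?\<delta> i) (?r (Suc i)) (?\<delta> (Suc i)) (h i)"
      "\<forall>i. \<forall>v\<in>free_module (?r (Suc i)).
        ?d (Suc i) (h (Suc i) v) = \<beta> (Suc i) (\<alpha> (Suc i) v) - v - h i (?d i v)"
    using homotopy_to_identity[OF X chain_map_compose[OF X \<alpha> \<beta>]] by (elim exE conjE)
  note h = h_dh(1)[rule_format] and dh = h_dh(2)[rule_format]
  have a: "graded_map (?r i) (?\<delta> i) (?s i) (?\<epsilon> i) (\<alpha> i)"
    and b: "graded_map (?s i) (?\<epsilon> i) (?r i) (?\<delta> i) (\<beta> i)" for i
    using \<alpha> \<beta> by (auto simp: chain_map_def)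
  have ad: "?e (Suc i) (\<alpha> (Suc (Suc i)) v) = \<alpha> (Suc i) (?d (Suc i) v)"
    if "v \<in> free_module (?r (Suc (Suc i)))" for i v
    by (rule chain_map_Suc[OF \<alpha> that])
  have bd: "?d (Suc i) (\<beta> (Suc (Suc i)) v) = \<beta> (Suc i) (?e (Suc i) v)"
    if "v \<in> free_module (?s (Suc (Suc i)))" for i v
    by (rule chain_map_Suc[OF \<beta> that])
  note lin = vec_linear_residue_map[OF graded_map_linear]
  note zero = module_hom.zero[OF lin]
  \<comment> \<open>Position \<open>Suc i\<close> of the augmented complex is position i of
    F.\<close>
  let ?f = "residue_map (\<alpha> (Suc i))"
  have cycles: "?f u \<in> tor_cycles G i j" if u: "u \<in> tor_cycles F i j" for u
  proof -
    have piece: "u \<in> residue_piece (?r (Suc i)) (?\<delta> (Suc i)) j"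
      using u by (simp add: tor_cycles_iff)
    then have free: "u \<in> free_module (?r (Suc i))" by (simp add: residue_piece_def)
    have "residue_map (?e i) (?f u) = 0" if "i \<noteq> 0"
    proof -
      obtain k where k: "i = Suc k" using \<open>i \<noteq> 0\<close> by (cases i) auto
      have "residue_map (?e i) (?f u) = residue_map (\<lambda>v. ?e i (\<alpha> (Suc i) v)) u"
        by (rule residue_map_compose[OF a graded_map_linear[OF e] free, symmetric])
      also have "\<dots> = residue_map (\<lambda>v. \<alpha> i (?d i v)) u"
        using ad free unfolding k by (rule residue_map_cong)
      also have "\<dots> = residue_map (\<alpha> i) (residue_map (?d i) u)"
        by (rule residue_map_compose[OF d graded_map_linear[OF a] free])
      also have "\<dots> = 0"
        using u \<open>i \<noteq> 0\<close> zero[OF a] by (simp add: tor_cycles_iff)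
      finally show ?thesis .
    qed
    then show ?thesis
      using residue_map_piece[OF a piece] by (simp add: tor_cycles_iff)
  qed
  \<comment> \<open>If \<open>?f u\<close> is the boundary of y, the reduced homotopy identity reads
    d(hu) = d(\<beta>y) - u: the remaining term vanishes since u is a cycle, or since
    \<open>h 0\<close> is zero when i = 0. So u is the boundary of \<beta>y - hu.\<close>
  have boundaries: "u \<in> tor_boundaries F i j"
    if u: "u \<in> tor_cycles F i j" and fu: "?f u \<in> tor_boundaries G i j" for u
  proof -
    have piece: "u \<in> residue_piece (?r (Suc i)) (?\<delta> (Suc i)) j"
      using u by (simp add: tor_cycles_iff)
    then have free: "u \<in> free_module (?r (Suc i))" by (simp add: residue_piece_def)
    obtain y where y: "y \<in> residue_piece (?s (Suc (Suc i))) (?\<epsilon> (Suc (Suc i))) j"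
      and fy: "?f u = residue_map (?e (Suc i)) y"
      using fu by (auto simp: tor_boundaries_eq simp del: aug_simps(5))
    have y_free: "y \<in> free_module (?s (Suc (Suc i)))" using y by (simp add: residue_piece_def)
    let ?by = "residue_map (\<beta> (Suc (Suc i))) y" and ?hu = "residue_map (h (Suc i)) u"
    have "residue_map (\<lambda>v. \<beta> (Suc i) (\<alpha> (Suc i) v)) u = residue_map (\<beta> (Suc i)) (?f u)"
      by (rule residue_map_compose[OF a graded_map_linear[OF b] free])
    also have "\<dots> = residue_map (\<lambda>v. \<beta> (Suc i) (?e (Suc i) v)) y"
      unfolding fy by (rule residue_map_compose[OF e graded_map_linear[OF b] y_free, symmetric])
    also have "\<dots> = residue_map (\<lambda>v. ?d (Suc i) (\<beta> (Suc (Suc i)) v)) y"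
      by (rule residue_map_cong[OF bd[symmetric] y_free])
    also have "\<dots> = residue_map (?d (Suc i)) ?by"
      by (rule residue_map_compose[OF b graded_map_linear[OF d] y_free])
    finally have ba: "residue_map (\<lambda>v. \<beta> (Suc i) (\<alpha> (Suc i) v)) u = residue_map (?d (Suc i)) ?by" .
    have hd: "residue_map (\<lambda>v. h i (?d i v)) u = 0"
    proof (cases "i = 0")
      case True
      then show ?thesis by (simp add: h0 residue_map_0)
    next
      case False
      then show ?thesis
        using u zero[OF h] residue_map_compose[OF d graded_map_linear[OF h] free]
        by (simp add: tor_cycles_iff)
    qed
    have "residue_map (?d (Suc i)) ?hu = residue_map (\<lambda>v. ?d (Suc i) (h (Suc i) v)) u"
      by (rule residue_map_compose[OF h graded_map_linear[OF d] free, symmetric])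
    also have "\<dots> = residue_map (\<lambda>v. \<beta> (Suc i) (\<alpha> (Suc i) v) - v) u
        - residue_map (\<lambda>v. h i (?d i v)) u"
      by (rule residue_map_diff[OF dh free])
    also have "residue_map (\<lambda>v. \<beta> (Suc i) (\<alpha> (Suc i) v) - v) u
        = residue_map (\<lambda>v. \<beta> (Suc i) (\<alpha> (Suc i) v)) u - residue_map (\<lambda>v :: nat \<Rightarrow> ('a, 'b) mpoly. v) u"
      by (rule residue_map_diff[OF refl free])
    finally have dhu: "residue_map (?d (Suc i)) ?hu = residue_map (?d (Suc i)) ?by - u - 0"
      unfolding ba hd residue_map_id .
    have "residue_map (?d (Suc i)) (?by - ?hu)
        = residue_map (?d (Suc i)) ?by - residue_map (?d (Suc i)) ?hu"
      by (rule module_hom.diff[OF lin[OF d]])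
    then have "u = residue_map (?d (Suc i)) (?by - ?hu)" unfolding dhu by simp
    moreover have "?by - ?hu \<in> residue_piece (?r (Suc (Suc i))) (?\<delta> (Suc (Suc i))) j"
      by (intro vec.subspace_diff subspace_residue_piece residue_map_piece[OF b y]
          residue_map_piece[OF h piece])
    ultimately show ?thesis by (auto simp: tor_boundaries_eq simp del: aug_simps(5))
  qed
  have subspaces: "vec.subspace (tor_cycles H i j)" "vec.subspace (tor_boundaries H i j)"
    "tor_boundaries H i j \<subseteq> tor_cycles H i j" "tor_cycles H i j \<subseteq> free_module (rk H i)"
    if H: "graded_free_resolution H I" for H
  proof -
    note Z = augmented_resolution[OF H I]
    note k = augmented_resolution_map[OF Z]
    have "tor_cycles H i j = residue_piece (rk H i) (bdeg H i) j \<inter>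
        {u. i \<noteq> 0 \<longrightarrow> residue_map (aug_differential H i) u = 0}"
      by (auto simp: tor_cycles_iff)
    moreover have "vec.subspace {u. i \<noteq> 0 \<longrightarrow> residue_map (aug_differential H i) u = 0}"
      using module_hom.subspace_kernel[OF lin[OF k]] by (cases "i = 0") auto
    ultimately show "vec.subspace (tor_cycles H i j)"
      by (simp add: vec.subspace_inter subspace_residue_piece)
    show "vec.subspace (tor_boundaries H i j)"
      unfolding tor_boundaries_eq
      by (rule module_hom.subspace_image[OF lin[OF k] subspace_residue_piece])
    show "tor_cycles H i j \<subseteq> free_module (rk H i)"
      by (auto simp: tor_cycles_iff residue_piece_def)
    show "tor_boundaries H i j \<subseteq> tor_cycles H i j"
    proof
      fix x assume "x \<in> tor_boundaries H i j"
      then obtain u where u: "u \<in> residue_piece (aug_rank H (Suc (Suc i))) (aug_deg H (Suc (Suc i))) j"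
        and x: "x = residue_map (aug_differential H (Suc i)) u"
        by (auto simp: tor_boundaries_eq simp del: aug_simps(5))
      then have free: "u \<in> free_module (aug_rank H (Suc (Suc i)))" by (simp add: residue_piece_def)
      have "residue_map (aug_differential H i) x = 0" if "i \<noteq> 0"
      proof -
        have "residue_map (aug_differential H i) x
            = residue_map (\<lambda>v. aug_differential H i (aug_differential H (Suc i) v)) u"
          unfolding x by (rule residue_map_compose[OF k graded_map_linear[OF k] free, symmetric])
        also have "\<dots> = residue_map (\<lambda>v :: nat \<Rightarrow> ('a, 'b) mpoly. 0) u"
        proof (rule residue_map_cong[OF _ free])
          fix v :: "nat \<Rightarrow> ('a, 'b) mpoly" assume "v \<in> free_module (aug_rank H (Suc (Suc i)))"
          from augmented_resolution_complex[OF Z this] \<open>i \<noteq> 0\<close>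
          show "aug_differential H i (aug_differential H (Suc i) v) = 0"
            by (simp add: relations_def)
        qed
        finally show ?thesis by (simp add: residue_map_0)
      qed
      moreover have "x \<in> residue_piece (aug_rank H (Suc i)) (aug_deg H (Suc i)) j"
        unfolding x by (rule residue_map_piece[OF k u])
      ultimately show "x \<in> tor_cycles H i j" by (simp add: tor_cycles_iff)
    qed
  qed
  have pair: "vector_space_pair (vscale :: 'b \<Rightarrow> _) (vscale :: 'b \<Rightarrow> _)"
    by (simp add: vector_space_pair_def vector_space_vscale)
  have "Vector_Spaces.linear vscale vscale ?f"
    using lin[OF a] by (simp add: Vector_Spaces.linear_def vector_space_vscale)
  then have "vector_space.dim vscale (tor_cycles F i j) - vector_space.dim vscale (tor_boundaries F i j)
      \<le> vector_space.dim vscale (tor_cycles G i j) - vector_space.dim vscale (tor_boundaries G i j)"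
  proof (rule vector_space_pair.dim_quotient_le[OF pair])
    show "tor_cycles F i j \<subseteq> vec.span (unit_vec ` {..<rk F i})"
      "tor_cycles G i j \<subseteq> vec.span (unit_vec ` {..<rk G i})"
      using subspaces(4)[OF F] subspaces(4)[OF G] free_module_subset_span by (meson subset_trans)+
  qed (use subspaces[OF F] subspaces[OF G] cycles boundaries in auto)
  then show ?thesis by (simp add: tor_dim_eq)
qed

text \<open>Releases \<open>betti\<close> from its arbitrary choice: the given resolution and the
  chosen one bound each other.\<close>

lemma betti_eq_tor_dim:
  assumes "homogeneous_ideal I" "graded_free_resolution F I"
  shows "betti I i j = tor_dim F i j"
  unfolding betti_def
  using tor_dim_le[OF assms(2) _ assms(1)] tor_dim_le[OF _ assms(2) assms(1)]
    someI[of "\<lambda>F. graded_free_resolution F I", OF assms(2)]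
  by (meson le_antisym)

section \<open>The resolution of a square power\<close>

text \<open>The substitution is a ring homomorphism, so images of generators suffice. Applied to
  homogeneous generators, this shows that the square power is homogeneous.\<close>

lemma square_power_generated:
  assumes I: "I = ideal_generated G"
  shows "square_power m I = ideal_generated (square_power_poly m ` G)"
proof -
  interpret R: module "(*) :: ('a, 'b) mpoly \<Rightarrow> _" by (rule module_mult)
  have "square_power_poly m f \<in> R.span (square_power_poly m ` G)" if "f \<in> R.span G" for f
    using that
    by (induction rule: R.span_induct_alt)
      (simp_all add: square_power_poly_add square_power_poly_mult R.span_zero R.span_add
        R.span_scale R.span_base)
  then have "square_power_poly m ` I \<subseteq> R.span (square_power_poly m ` G)"
    by (auto simp: I ideal_generated_def)
  moreover have "square_power_poly m ` G \<subseteq> R.span (square_power_poly m ` I)"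
    by (auto simp: I ideal_generated_def intro: R.span_base)
  ultimately show ?thesis by (simp add: square_power_def ideal_generated_def R.span_eq)
qed

lemma homogeneous_ideal_square_power:
  assumes "homogeneous_ideal I"
  shows "homogeneous_ideal (square_power m I)"
proof -
  interpret R: module "(*) :: ('a, 'b) mpoly \<Rightarrow> _" by (rule module_mult)
  obtain G where G: "G \<subseteq> (\<Union>d. homogeneous_component d)" "I = ideal_generated G"
    using assms by (auto simp: homogeneous_ideal_def)
  have "square_power_poly m ` G \<subseteq> (\<Union>d. homogeneous_component d)"
  proof clarify
    fix f assume "f \<in> G"
    then obtain d where "f \<in> homogeneous_component d" using G(1) by blast
    from square_power_poly_homogeneous[OF this, of m]
    show "square_power_poly m f \<in> (\<Union>d. homogeneous_component d)" by blast
  qed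
  moreover have "ideal (square_power m I)"
    by (simp add: ideal_def square_power_def ideal_generated_def)
  ultimately show ?thesis
    using square_power_generated[OF G(2)] by (auto simp: homogeneous_ideal_def)
qed

lemma square_power_poly_in: "f \<in> I \<Longrightarrow> square_power_poly m f \<in> square_power m I"
  by (simp add: square_power_def ideal_generated_def module.span_base[OF module_mult])

lemma square_power_mult: "f \<in> square_power m I \<Longrightarrow> g * f \<in> square_power m I"
  by (simp add: square_power_def ideal_generated_def module.span_scale[OF module_mult])

lemma square_power_sum:
  "(\<And>x. x \<in> A \<Longrightarrow> h x \<in> square_power m I) \<Longrightarrow> sum h A \<in> square_power m I"
  by (simp add: square_power_def ideal_generated_def module.span_sum[OF module_mult])

text \<open>By \<open>coordinate_mult\<close>, a multiple of the image of g has coordinates that are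
  multiples of g. This carries exactness at position 0, where membership in the ideal replaces
  vanishing.\<close>

lemma coordinate_square_power:
  assumes I: "ideal I" and a: "a \<in> reduced_exponents m" and m: "m \<noteq> 0"
    and f: "f \<in> square_power m I"
  shows "coordinate m a f \<in> I"
proof -
  interpret R: module "(*) :: ('a, 'b) mpoly \<Rightarrow> _" by (rule module_mult)
  have sub: "R.subspace I" using I by (simp add: ideal_def)
  have "f \<in> R.span (square_power_poly m ` I)"
    using f by (simp add: square_power_def ideal_generated_def)
  then show ?thesis
  proof (induction rule: R.span_induct_alt)
    case (step c x y)
    then obtain g where g: "g \<in> I" "x = square_power_poly m g" by blast
    have "coordinate m a (c * x + y) = coordinate m a c * g + coordinate m a y"
      using coordinate_mult[OF a m, of g c] by (simp add: g(2) coordinate_add[OF m] mult.commute)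
    then show ?case using step g(1) sub by (simp add: R.subspace_add R.subspace_scale)
  qed (simp add: m R.subspace_0[OF sub])
qed

section \<open>The transformed complex and its exactness, coordinate by coordinate\<close>

definition square_power_complex ::
  "nat \<Rightarrow> ('n::finite, 'k::field) mpoly graded_complex \<Rightarrow> ('n, 'k) mpoly graded_complex" where
  "square_power_complex m F = \<lparr>rk = rk F, bdeg = (\<lambda>i b. int m * bdeg F i b),
    dmat = (\<lambda>i c b. square_power_poly m (dmat F i c b)), aug = (\<lambda>b. square_power_poly m (aug F b))\<rparr>"

lemma square_power_complex_simps [simp]:
  "rk (square_power_complex m F) = rk F"
  "bdeg (square_power_complex m F) i b = int m * bdeg F i b"
  "dmat (square_power_complex m F) i c b = square_power_poly m (dmat F i c b)"
  "aug (square_power_complex m F) b = square_power_poly m (aug F b)"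
  by (simp_all add: square_power_complex_def)

text \<open>Inverse to the expansion in coordinates: \<open>w a b\<close> is the coordinate of entry
  b at the basis monomial X^a.\<close>

definition from_coordinates ::
  "nat \<Rightarrow> (('n::finite \<Rightarrow>\<^sub>0 nat) \<Rightarrow> nat \<Rightarrow> ('n, 'k::field) mpoly) \<Rightarrow> nat \<Rightarrow> ('n, 'k) mpoly" where
  "from_coordinates m w
    = (\<lambda>b. \<Sum>a\<in>reduced_exponents m. monomial a 1 * square_power_poly m (w a b))"

lemma from_coordinates_coordinate:
  "m \<noteq> 0 \<Longrightarrow> from_coordinates m (\<lambda>a b. coordinate m a (v b)) = v"
  by (simp add: from_coordinates_def sum_coordinates)

lemma from_coordinates_cong:
  "(\<And>a. a \<in> reduced_exponents m \<Longrightarrow> w a = w' a) \<Longrightarrow> from_coordinates m w = from_coordinates m w'"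
  by (simp add: from_coordinates_def cong: sum.cong)

lemma from_coordinates_in_free_module:
  "(\<And>a. a \<in> reduced_exponents m \<Longrightarrow> w a \<in> free_module r) \<Longrightarrow>
    from_coordinates m w \<in> free_module r"
  by (simp add: from_coordinates_def free_module_def)

lemma sum_from_coordinates:
  "(\<Sum>b\<in>B. square_power_poly m (p b) * from_coordinates m w b)
    = (\<Sum>a\<in>reduced_exponents m. monomial a 1 * square_power_poly m (\<Sum>b\<in>B. p b * w a b))"
  by (simp add: from_coordinates_def square_power_poly_sum square_power_poly_mult sum_distrib_left
      sum.swap[of _ B] mult.left_commute)

text \<open>The entries of the transformed matrix lie in the subring over which the reduced
  monomials form a basis. On coordinates the new complex is thus a direct sum of copies of the old
  one, one for each reduced exponent vector.\<close>

lemma differential_from_coordinates: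
  "differential r (\<lambda>i c b. square_power_poly m (A i c b)) i (from_coordinates m w)
    = from_coordinates m (\<lambda>a. differential r A i (w a))"
proof
  fix c
  show "differential r (\<lambda>i c b. square_power_poly m (A i c b)) i (from_coordinates m w) c
    = from_coordinates m (\<lambda>a. differential r A i (w a)) c"
    unfolding differential_def sum_from_coordinates by (simp add: from_coordinates_def)
qed

lemma coordinate_differential:
  assumes "a \<in> reduced_exponents m" "m \<noteq> 0"
  shows "(\<lambda>c. coordinate m a (differential r (\<lambda>i c b. square_power_poly m (A i c b)) i v c))
    = differential r A i (\<lambda>b. coordinate m a (v b))"
  using assms by (simp add: differential_def fun_eq_iff coordinate_sum coordinate_mult)

lemma graded_free_resolution_square_power:
  assumes F: "graded_free_resolution F I" and I: "homogeneous_ideal I" and m: "m \<noteq> 0"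
  shows "graded_free_resolution (square_power_complex m F) (square_power m I)"
proof -
  let ?F = "square_power_complex m F" and ?J = "square_power m I"
  let ?d = "differential (rk F) (dmat F)" and ?e = "differential (rk ?F) (dmat ?F)"
  have aug_deg: "\<forall>b<rk F 0. aug F b \<in> homogeneous_component (bdeg F 0 b)"
    and dmat_deg: "\<forall>i\<ge>1. \<forall>c<rk F (i - 1). \<forall>b<rk F i.
        dmat F i c b \<in> homogeneous_component (bdeg F i b - bdeg F (i - 1) c)"
    and onto: "\<forall>f. \<exists>v\<in>free_module (rk F 0). f - augmentation F v \<in> I"
    and exact0: "{v \<in> free_module (rk F 0). augmentation F v \<in> I} = ?d 1 ` free_module (rk F 1)"
    and exactF: "\<forall>i\<ge>1.
      {v \<in> free_module (rk F i). ?d i v = 0} = ?d (i + 1) ` free_module (rk F (i + 1))"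
    by (rule F[unfolded graded_free_resolution_def, THEN conjunct1]
        F[unfolded graded_free_resolution_def, THEN conjunct2, THEN conjunct1]
        F[unfolded graded_free_resolution_def, THEN conjunct2, THEN conjunct2, THEN conjunct1]
        F[unfolded graded_free_resolution_def, THEN conjunct2, THEN conjunct2, THEN conjunct2,
          THEN conjunct1]
        F[unfolded graded_free_resolution_def, THEN conjunct2, THEN conjunct2, THEN conjunct2,
          THEN conjunct2])+
  note exact = exactF[rule_format]
  have "ideal I" using I by (simp add: homogeneous_ideal_def)
  have e: "?e = differential (rk F) (\<lambda>i c b. square_power_poly m (dmat F i c b))"
    by (simp add: square_power_complex_def)
  have e_from: "?e i (from_coordinates m w) = from_coordinates m (\<lambda>a. ?d i (w a))" for i w
    unfolding e by (rule differential_from_coordinates)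
  have e_coord: "(\<lambda>c. coordinate m a (?e i v c)) = ?d i (\<lambda>b. coordinate m a (v b))"
    if "a \<in> reduced_exponents m" for a i v
    unfolding e by (rule coordinate_differential[OF that m])
  have aug_from: "augmentation ?F (from_coordinates m w)
      = (\<Sum>a\<in>reduced_exponents m. monomial a 1 * square_power_poly m (augmentation F (w a)))" for w
    by (simp add: augmentation_def sum_from_coordinates)
  have aug_coord: "coordinate m a (augmentation ?F v) = augmentation F (\<lambda>b. coordinate m a (v b))"
    if "a \<in> reduced_exponents m" for a v
    using that m by (simp add: augmentation_def coordinate_sum coordinate_mult)
  have coord_free: "(\<lambda>b. coordinate m a (v b)) \<in> free_module r" if "v \<in> free_module r" for a v r
    using that m by (simp add: free_module_def)
  \<comment> \<open>Preimages are chosen separately for every reduced exponent vector and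
    reassembled into one vector.\<close>
  have image: "v \<in> ?e i ` free_module (rk F i)"
    if "\<And>a. a \<in> reduced_exponents m \<Longrightarrow>
      (\<lambda>b. coordinate m a (v b)) \<in> ?d i ` free_module (rk F i)" for v i
  proof -
    have "\<forall>a\<in>reduced_exponents m. \<exists>u\<in>free_module (rk F i). (\<lambda>b. coordinate m a (v b)) = ?d i u"
      using that by blast
    then obtain w where w: "\<forall>a\<in>reduced_exponents m. w a \<in> free_module (rk F i) \<and>
        (\<lambda>b. coordinate m a (v b)) = ?d i (w a)"
      unfolding Bex_def by (rule bchoice[THEN exE])
    have "v = from_coordinates m (\<lambda>a b. coordinate m a (v b))"
      by (rule from_coordinates_coordinate[OF m, symmetric])
    also have "\<dots> = from_coordinates m (\<lambda>a. ?d i (w a))"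
      using w by (intro from_coordinates_cong) blast
    also have "\<dots> = ?e i (from_coordinates m w)" by (rule e_from[symmetric])
    finally have "v = ?e i (from_coordinates m w)" .
    moreover have "from_coordinates m w \<in> free_module (rk F i)"
      using w by (intro from_coordinates_in_free_module) blast
    ultimately show ?thesis by (rule image_eqI)
  qed
  have complex0: "augmentation F (?d 1 u) \<in> I" if "u \<in> free_module (rk F 1)" for u
    using exact0 that by blast
  have complex: "?d i (?d (i + 1) u) = 0" if "i \<ge> 1" "u \<in> free_module (rk F (i + 1))" for i u
    using exact[OF that(1)] that(2) by blast
  have e_free: "?e (Suc i) v \<in> free_module (rk F i)" for i v
    by (simp add: differential_def free_module_def)
  show ?thesis
    unfolding graded_free_resolution_def
  proof (intro conjI allI impI)
    fix b assume "b < rk ?F 0"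
    then show "aug ?F b \<in> homogeneous_component (bdeg ?F 0 b)"
      by (simp add: square_power_poly_homogeneous aug_deg)
  next
    fix i c b :: nat assume "1 \<le> i" "c < rk ?F (i - 1)" "b < rk ?F i"
    then show "dmat ?F i c b \<in> homogeneous_component (bdeg ?F i b - bdeg ?F (i - 1) c)"
      using square_power_poly_homogeneous[OF dmat_deg[rule_format, of i c b], of m]
      by (simp add: right_diff_distrib)
  next
    fix f
    \<comment> \<open>The quotient by the square power is generated by the class of 1, so it is
      enough to transform a preimage of 1 and multiply by f.\<close>
    obtain v where v: "v \<in> free_module (rk F 0)" "1 - augmentation F v \<in> I"
      using onto by blast
    let ?v = "\<lambda>b. f * square_power_poly m (v b)"
    have "?v \<in> free_module (rk ?F 0)" using v(1) by (simp add: free_module_def)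
    moreover have "f - augmentation ?F ?v = f * square_power_poly m (1 - augmentation F v)"
      by (simp add: augmentation_def square_power_poly_diff square_power_poly_sum
          square_power_poly_mult right_diff_distrib sum_distrib_left mult.left_commute)
    moreover have "f * square_power_poly m (1 - augmentation F v) \<in> ?J"
      by (intro square_power_mult square_power_poly_in v(2))
    ultimately show "\<exists>v\<in>free_module (rk ?F 0). f - augmentation ?F v \<in> ?J" by metis
  next
    show "{v \<in> free_module (rk ?F 0). augmentation ?F v \<in> ?J} = ?e 1 ` free_module (rk ?F 1)"
    proof (intro equalityI subsetI)
      fix v assume "v \<in> {v \<in> free_module (rk ?F 0). augmentation ?F v \<in> ?J}"
      then have v: "v \<in> free_module (rk F 0)" "augmentation ?F v \<in> ?J" by simp_all
      have "(\<lambda>b. coordinate m a (v b)) \<in> ?d 1 ` free_module (rk F 1)"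
        if a: "a \<in> reduced_exponents m" for a
        using coordinate_square_power[OF \<open>ideal I\<close> a m v(2)] coord_free[OF v(1)]
        unfolding exact0[symmetric] aug_coord[OF a] by blast
      then show "v \<in> ?e 1 ` free_module (rk ?F 1)" using image by simp
    next
      fix v assume "v \<in> ?e 1 ` free_module (rk ?F 1)"
      then obtain u where u: "u \<in> free_module (rk F 1)" and v: "v = ?e 1 u" by auto
      have "v = from_coordinates m (\<lambda>a. ?d 1 (\<lambda>b. coordinate m a (u b)))"
        unfolding v using e_from[of 1 "\<lambda>a b. coordinate m a (u b)"]
        by (simp only: from_coordinates_coordinate[OF m])
      then have "augmentation ?F v \<in> ?J"
        using complex0[OF coord_free[OF u]]
        by (auto simp: aug_from intro!: square_power_sum square_power_mult square_power_poly_in)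
      then show "v \<in> {v \<in> free_module (rk ?F 0). augmentation ?F v \<in> ?J}"
        using e_free[of 0 u] v by simp
    qed
  next
    fix i :: nat assume i: "1 \<le> i"
    show "{v \<in> free_module (rk ?F i). ?e i v = 0} = ?e (i + 1) ` free_module (rk ?F (i + 1))"
    proof (intro equalityI subsetI)
      fix v assume "v \<in> {v \<in> free_module (rk ?F i). ?e i v = 0}"
      then have v: "v \<in> free_module (rk F i)" "?e i v = 0" by simp_all
      have "(\<lambda>b. coordinate m a (v b)) \<in> ?d (i + 1) ` free_module (rk F (i + 1))"
        if a: "a \<in> reduced_exponents m" for a
      proof -
        have "?d i (\<lambda>b. coordinate m a (v b)) = 0"
          using e_coord[OF a, of i v] m v(2) by (simp add: fun_eq_iff)
        then show ?thesis using coord_free[OF v(1)] unfolding exact[OF i, symmetric] by blast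
      qed
      then show "v \<in> ?e (i + 1) ` free_module (rk ?F (i + 1))" using image by simp
    next
      fix v assume "v \<in> ?e (i + 1) ` free_module (rk ?F (i + 1))"
      then obtain u where u: "u \<in> free_module (rk F (i + 1))" and v: "v = ?e (i + 1) u" by auto
      have "?e i v = from_coordinates m (\<lambda>a. ?d i (?d (i + 1) (\<lambda>b. coordinate m a (u b))))"
        unfolding v e_from[symmetric] from_coordinates_coordinate[OF m] ..
      also have "\<dots> = 0"
        using complex[OF i coord_free[OF u]] by (simp add: from_coordinates_def fun_eq_iff)
      finally show "v \<in> {v \<in> free_module (rk ?F i). ?e i v = 0}"
        using e_free[of i u] v by simp
    qed
  qed
qed

lemma tor_dim_square_power_complex:
  assumes m: "m \<noteq> 0"
  shows "tor_dim (square_power_complex m F) i (int m * k) = tor_dim F i k"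
proof -
  have "tensor_piece (square_power_complex m F) i (int m * k) = tensor_piece F i k" for i
    using m by (simp add: tensor_piece_def)
  moreover have "tensor_differential (square_power_complex m F) = tensor_differential F"
    by (simp add: tensor_differential_def const_coeff_square_power_poly[OF m])
  ultimately show ?thesis by (simp add: tor_dim_def tor_cycles_def tor_boundaries_def)
qed

text \<open>Every basis element has degree divisible by m, so in the remaining degrees the tensor
  pieces themselves are zero.\<close>

lemma tor_dim_square_power_complex_nonzero:
  assumes "tor_dim (square_power_complex m F) i j \<noteq> 0"
  shows "\<exists>k. j = int m * k"
proof (rule ccontr)
  assume "\<nexists>k. j = int m * k"
  then have "tor_cycles (square_power_complex m F) i j \<subseteq> {0}"
    unfolding tor_cycles_def tensor_piece_def by (force simp: fun_eq_iff)
  then have "tor_cycles (square_power_complex m F) i j \<subseteq> vec.span {}" by simp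
  then have "vector_space.dim vscale (tor_cycles (square_power_complex m F) i j)
      \<le> card ({} :: (nat \<Rightarrow> 'b) set)"
    by (rule vector_space.dim_le_card[OF vector_space_vscale]) simp
  then show False using assms by (simp add: tor_dim_eq)
qed

theorem corollary2p7:
  fixes I :: "('n::finite, 'k::field) mpoly set" and m :: nat
  assumes "homogeneous_ideal I" and "m \<ge> 2"
  shows "(\<forall>(i::nat) (j::int). betti (square_power m I) i j \<noteq> 0 \<longrightarrow>
            (\<exists>k::int. j = int m * k \<and> betti I i k \<noteq> 0)) \<and>
         (\<forall>(i::nat) (k::int). betti (square_power m I) i (int m * k) = betti I i k)"
proof -
  have m: "m \<noteq> 0" using assms(2) by simp
  obtain F where F: "graded_free_resolution F I"
    using graded_free_resolution_exists[OF assms(1)] by blast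
  have I: "betti I i j = tor_dim F i j" for i j
    by (rule betti_eq_tor_dim[OF assms(1) F])
  have J: "betti (square_power m I) i j = tor_dim (square_power_complex m F) i j" for i j
    by (rule betti_eq_tor_dim[OF homogeneous_ideal_square_power[OF assms(1)]
          graded_free_resolution_square_power[OF F assms(1) m]])
  have eq: "betti (square_power m I) i (int m * k) = betti I i k" for i k
    by (simp add: I J tor_dim_square_power_complex[OF m])
  moreover have "\<exists>k. j = int m * k \<and> betti I i k \<noteq> 0" if "betti (square_power m I) i j \<noteq> 0" for i j
    using tor_dim_square_power_complex_nonzero[of m F i j] that eq J by metis
  ultimately show ?thesis by blast
qed

end
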